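(* Let $d\ge 1$ be an integer and let $f,-g,h_1,\ldots,h_m:\mathbb{R}^n\to\mathbb{R}$ be SOS-convex polynomials of degree at most $2d$. Let $K:=\{x\in\mathbb{R}^n\mid h_i(x)\le 0,\ i=1,\ldots,m\}$, and assume that $K$ is nonempty and that $f(x)\ge 0$ and $g(x)>0$ for every $x\in K$. If the Slater condition holds, i.e., there exists $\hat{x}\in\mathbb{R}^n$ with $h_i(\hat{x})<0$ for all $i=1,\ldots,m$, then $$\inf\,(\mathrm{FP})=\max\,(\mathrm{D}')=\inf\,(\mathrm{Q}'),$$ where $\max$ means that the supremum in (D$'$) is attained. Moreover, if $\bar{y}$ is an optimal solution to (Q$'$) with $\bar{y}_0\neq 0$, then $$\bar{x}:=\frac{1}{\bar{y}_0}\bigl(L_{\bar{y}}(x_1),\ldots,L_{\bar{y}}(x_n)\bigr)$$ is an optimal solution to the problem (FP).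
   Context: A polynomial $q\in\mathbb{R}[x]$, $x=(x_1,\ldots,x_n)$, is called SOS-convex if there exist an integer $p\ge 1$ and a polynomial matrix $F\in\mathbb{R}[x]^{n\times p}$ such that $\nabla^2 q(x)=F(x)F(x)^T$. $\Sigma[x]_{2d}$ denotes the cone of real polynomials of degree at most $2d$ that are sums of squares of real polynomials; $\mathbb{R}[x]_{2d}$ is the space of real polynomials of degree at most $2d$. For $k\in\mathbb{N}$ (nonnegative integers), $\mathbb{N}^n_k:=\{\alpha\in\mathbb{N}^n\mid \alpha_1+\cdots+\alpha_n\le k\}$ and $s(n,k):=\binom{n+k}{n}$ is its cardinality. For $y=(y_\alpha)_{\alpha\in\mathbb{N}^n_{2d}}\in\mathbb{R}^{s(n,2d)}$: the linear functional $L_y:\mathbb{R}[x]_{2d}\to\mathbb{R}$ is $L_y(p):=\sum_{\alpha\in\mathbb{N}^n_{2d}}p_\alpha y_\alpha$ for $p=\sum_\alpha p_\alpha x^\alpha$; the moment matrix $\mathbf{M}_d(y)$ is the symmetric matrix indexed by $\mathbb{N}^n_d$ with entries $\mathbf{M}_d(y)(\alpha,\beta)=y_{\alpha+\beta}$; $y_0$ is the entry of $y$ with index $\alpha=0$. $M\succeq 0$ means $M$ is positive semidefinite. (FP) is the fractional program $\inf_{x\in K}\frac{f(x)}{g(x)}$. (D$'$) is the problem, in the variables $\lambda\in\mathbb{R}^m$, $\gamma\in\mathbb{R}$: maximize $\gamma$ subject to $f+\sum_{i=1}^m\lambda_i h_i-\gamma g\in\Sigma[x]_{2d}$, $\;\lambda_i\ge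 0$ for $i=1,\ldots,m$, and $\gamma\ge 0$. (Q$'$) is the problem, in the variable $y\in\mathbb{R}^{s(n,2d)}$: minimize $L_y(f)$ subject to $1-L_y(g)\le 0$, $\;L_y(h_i)\le 0$ for $i=1,\ldots,m$, and $\mathbf{M}_d(y)\succeq 0$. *)

theory Defs
  imports "HOL-Analysis.Analysis" "HOL-Library.Poly_Mapping"
begin

section \<open>Real polynomials in finitely many variables\<close>

text \<open>
  The ring of real polynomials in $n$ variables is the library ring of finitely supported
  functions from exponent vectors to coefficients; the variables are indexed by a finite
  type \<open>'n\<close> with $n$ elements.
\<close>

type_synonym 'n expo = "'n \<Rightarrow>\<^sub>0 nat"
type_synonym 'n rpoly = "'n expo \<Rightarrow>\<^sub>0 real"

definition Const :: "real \<Rightarrow> 'n rpoly" where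
  "Const c = Poly_Mapping.single 0 c"

definition Var :: "'n \<Rightarrow> 'n rpoly" where
  "Var i = Poly_Mapping.single (Poly_Mapping.single i 1) 1"

definition peval :: "'n::finite rpoly \<Rightarrow> real ^ 'n \<Rightarrow> real" where
  "peval p x = (\<Sum>\<alpha>\<in>Poly_Mapping.keys p.
     Poly_Mapping.lookup p \<alpha> * (\<Prod>i\<in>UNIV. (x $ i) ^ Poly_Mapping.lookup \<alpha> i))"

definition expos :: "nat \<Rightarrow> 'n::finite expo set" where
  "expos k = {\<alpha>. (\<Sum>i\<in>UNIV. Poly_Mapping.lookup \<alpha> i) \<le> k}"

definition polys :: "nat \<Rightarrow> 'n::finite rpoly set" where
  "polys k = {p. Poly_Mapping.keys p \<subseteq> expos k}"

text \<open>
  Formal partial derivative. The subtraction of exponents is truncated, which only matters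
  when $\alpha_i = 0$; that term has coefficient $0$.
\<close>

definition partial :: "'n \<Rightarrow> 'n rpoly \<Rightarrow> 'n rpoly" where
  "partial i p = (\<Sum>\<alpha>\<in>Poly_Mapping.keys p.
     Poly_Mapping.single (\<alpha> - Poly_Mapping.single i 1)
       (real (Poly_Mapping.lookup \<alpha> i) * Poly_Mapping.lookup p \<alpha>))"

definition hessian :: "'n rpoly \<Rightarrow> 'n \<Rightarrow> 'n \<Rightarrow> 'n rpoly" where
  "hessian q i j = partial i (partial j q)"

text \<open>
  The number \<open>p\<close> of columns of the factor \<open>F\<close> is existentially quantified, so its column
  index ranges over the natural numbers below \<open>p\<close>.
\<close>

definition sos_convex :: "'n rpoly \<Rightarrow> bool" where
  "sos_convex q \<longleftrightarrow> (\<exists>p\<ge>1. \<exists>F :: 'n \<Rightarrow> nat \<Rightarrow> 'n rpoly.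
     \<forall>i j. hessian q i j = (\<Sum>k<p. F i k * F j k))"

definition sos :: "'n rpoly \<Rightarrow> bool" where
  "sos q \<longleftrightarrow> (\<exists>(r::nat) u. q = (\<Sum>k<r. u k ^ 2))"

definition Sigma_sos :: "nat \<Rightarrow> 'n::finite rpoly set" where
  "Sigma_sos k = {q \<in> polys k. sos q}"


section \<open>Truncated moment sequences\<close>

text \<open>
  An element of $\mathbb{R}^{s(n,2d)}$ is a real function on exponents that is extensional
  on \<open>expos (2 * d)\<close>, i.e. undefined elsewhere.
\<close>

definition mom_space :: "nat \<Rightarrow> ('n::finite expo \<Rightarrow> real) set" where
  "mom_space d = extensional (expos (2 * d))"

definition Lfun :: "nat \<Rightarrow> ('n::finite expo \<Rightarrow> real) \<Rightarrow> 'n rpoly \<Rightarrow> real" where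
  "Lfun d y p = (\<Sum>\<alpha>\<in>expos (2 * d). Poly_Mapping.lookup p \<alpha> * y \<alpha>)"

text \<open>Positive semidefiniteness of a real matrix whose rows and columns are indexed by \<open>I\<close>.\<close>

definition psd_on :: "'i set \<Rightarrow> ('i \<Rightarrow> 'i \<Rightarrow> real) \<Rightarrow> bool" where
  "psd_on I M \<longleftrightarrow> (\<forall>a\<in>I. \<forall>b\<in>I. M a b = M b a) \<and>
     (\<forall>v. 0 \<le> (\<Sum>a\<in>I. \<Sum>b\<in>I. v a * M a b * v b))"

definition moment_matrix :: "('n expo \<Rightarrow> real) \<Rightarrow> 'n expo \<Rightarrow> 'n expo \<Rightarrow> real" where
  "moment_matrix y \<alpha> \<beta> = y (\<alpha> + \<beta>)"


section \<open>The optimization problems\<close>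

text \<open>
  The constraints are \<open>h 1, \<dots>, h m\<close>. Infima are taken in the extended reals.
\<close>

definition feas_K :: "nat \<Rightarrow> (nat \<Rightarrow> 'n::finite rpoly) \<Rightarrow> (real ^ 'n) set" where
  "feas_K m h = {x. \<forall>i\<in>{1..m}. peval (h i) x \<le> 0}"

definition obj_FP :: "'n::finite rpoly \<Rightarrow> 'n rpoly \<Rightarrow> real ^ 'n \<Rightarrow> real" where
  "obj_FP f g x = peval f x / peval g x"

definition inf_FP :: "nat \<Rightarrow> 'n::finite rpoly \<Rightarrow> 'n rpoly \<Rightarrow> (nat \<Rightarrow> 'n rpoly) \<Rightarrow> ereal" where
  "inf_FP m f g h = (INF x\<in>feas_K m h. ereal (obj_FP f g x))"

definition feas_D ::
  "nat \<Rightarrow> nat \<Rightarrow> 'n::finite rpoly \<Rightarrow> 'n rpoly \<Rightarrow> (nat \<Rightarrow> 'n rpoly) \<Rightarrow> ((nat \<Rightarrow> real) \<times> real) set" where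
  "feas_D d m f g h = {(l, \<gamma>). l \<in> extensional {1..m} \<and>
     f + (\<Sum>i\<in>{1..m}. Const (l i) * h i) - Const \<gamma> * g \<in> Sigma_sos (2 * d) \<and>
     (\<forall>i\<in>{1..m}. l i \<ge> 0) \<and> \<gamma> \<ge> 0}"

definition feas_Q ::
  "nat \<Rightarrow> nat \<Rightarrow> 'n::finite rpoly \<Rightarrow> (nat \<Rightarrow> 'n rpoly) \<Rightarrow> ('n expo \<Rightarrow> real) set" where
  "feas_Q d m g h = {y \<in> mom_space d. 1 - Lfun d y g \<le> 0 \<and>
     (\<forall>i\<in>{1..m}. Lfun d y (h i) \<le> 0) \<and> psd_on (expos d) (moment_matrix y)}"

definition inf_Q ::
  "nat \<Rightarrow> nat \<Rightarrow> 'n::finite rpoly \<Rightarrow> 'n rpoly \<Rightarrow> (nat \<Rightarrow> 'n rpoly) \<Rightarrow> ereal" where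
  "inf_Q d m f g h = (INF y\<in>feas_Q d m g h. ereal (Lfun d y f))"

end

theory Submission
  imports Defs "HOL-Computational_Algebra.Polynomial"
begin

text \<open>
  Everything rests on one property of an SOS-convex polynomial $q$: its tangent remainder
  $q(x)-q(u)-\nabla q(u)^T(x-u)$ is, for each $u$, a sum of squares of polynomials in $x$
  (\<open>sos_convex_tangent_remainder\<close>). It has three consequences. First, $q$ is convex. Second, a nonnegative $q$ is
  itself a sum of squares, since a convex polynomial that is bounded below attains its minimum
  (\<open>convex_poly_attains_min\<close>), where the linear part of the expansion vanishes (\<open>nonneg_imp_sos\<close>). Third, Jensen's
  inequality holds with a moment functional in place of an expectation (\<open>Lfun_jensen\<close>), because such a functional is
  nonnegative on sums of squares of degree at most $2d$ (\<open>Lfun_sos_nonneg\<close>).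

  Let $\gamma$ be the infimum of $f/g$ on $K$; then $\gamma\ge 0$ and $f-\gamma g\ge 0$ on $K$. This function is convex,
  so the Slater condition provides multipliers $\lambda_i\ge 0$ such that $f+\sum_i\lambda_ih_i-\gamma g$ is nonnegative on
  the whole space (\<open>lagrange_multipliers\<close>). By the second consequence it is a sum of squares, so $(\lambda,\gamma)$ is feasible for
  the dual problem (\<open>strong_duality\<close>). Conversely, the value of a dual feasible point is at most
  that of any feasible moment sequence (\<open>weak_duality\<close>), and a point $x\in K$ gives the feasible moment sequence of the
  point mass $1/g(x)$ at $x$, with value $f(x)/g(x)$ (\<open>feas_Q_point_moments\<close>). Hence the three values agree and the dual
  one is attained at $\gamma$.

  For the last claim, Jensen's inequality for $h_i$, $f$ and $-g$ at the barycentre of an optimal moment sequence $y$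
  of mass $y_0>0$
  shows that this point is feasible and that its ratio is at most $L_y(f)$, which is at most the ratio at every point of
  $K$ by the embedding of point masses.
\<close>

section \<open>Polynomials as functions\<close>

text \<open>Bounded total degree bounds every single exponent, so exponent vectors embed into a finite function space.\<close>

lemma finite_expos: "finite (expos k :: 'n::finite expo set)"
proof -
  have "expos k \<subseteq> Poly_Mapping.Abs_poly_mapping ` ((UNIV::'n set) \<rightarrow>\<^sub>E {..k})"
  proof
    fix a :: "'n expo" assume a: "a \<in> expos k"
    have "Poly_Mapping.lookup a i \<le> k" for i
      using a member_le_sum[of i UNIV "Poly_Mapping.lookup a"] by (auto simp: expos_def)
    then have "Poly_Mapping.lookup a \<in> (UNIV::'n set) \<rightarrow>\<^sub>E {..k}" by auto
    then show "a \<in> Poly_Mapping.Abs_poly_mapping ` ((UNIV::'n set) \<rightarrow>\<^sub>E {..k})"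
      by (metis Poly_Mapping.lookup_inverse image_eqI)
  qed
  then show ?thesis by (rule finite_subset) (intro finite_imageI finite_PiE, auto)
qed

lemma sum_of_terms:
  fixes p :: "'a \<Rightarrow>\<^sub>0 'b::comm_monoid_add"
  assumes "finite S" "Poly_Mapping.keys p \<subseteq> S"
  shows "p = (\<Sum>\<alpha>\<in>S. Poly_Mapping.single \<alpha> (Poly_Mapping.lookup p \<alpha>))"
proof (rule poly_mapping_eqI)
  fix \<beta>
  show "Poly_Mapping.lookup p \<beta> =
    Poly_Mapping.lookup (\<Sum>\<alpha>\<in>S. Poly_Mapping.single \<alpha> (Poly_Mapping.lookup p \<alpha>)) \<beta>"
    using assms
    by (auto simp: lookup_sum lookup_single when_def sum.delta in_keys_iff)
qed

definition monom_eval :: "'n::finite expo \<Rightarrow> real ^ 'n \<Rightarrow> real" where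
  "monom_eval \<alpha> x = (\<Prod>i\<in>UNIV. (x $ i) ^ Poly_Mapping.lookup \<alpha> i)"

lemma monom_eval_add: "monom_eval (\<alpha> + \<beta>) x = monom_eval \<alpha> x * monom_eval \<beta> x"
  by (simp add: monom_eval_def lookup_add power_add prod.distrib)

lemma monom_eval_0 [simp]: "monom_eval 0 x = 1"
  by (simp add: monom_eval_def)

lemma monom_eval_at_0: "monom_eval \<alpha> 0 = (if \<alpha> = 0 then 1 else 0)"
proof (cases "\<alpha> = 0")
  case False
  then obtain i where "Poly_Mapping.lookup \<alpha> i \<noteq> 0" by (metis lookup_zero poly_mapping_eqI)
  then show ?thesis using False by (auto simp: monom_eval_def intro!: prod_zero)
qed simp

text \<open>Summing over any finite set that contains the support makes it possible to compare polynomials with different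
supports termwise.\<close>

lemma peval_superset:
  assumes "finite S" "Poly_Mapping.keys p \<subseteq> S"
  shows "peval p x = (\<Sum>\<alpha>\<in>S. Poly_Mapping.lookup p \<alpha> * monom_eval \<alpha> x)"
  unfolding peval_def monom_eval_def using assms
  by (intro sum.mono_neutral_left) (auto simp: in_keys_iff)

lemma peval_0 [simp]: "peval 0 x = 0"
  by (simp add: peval_def)

lemma peval_single [simp]: "peval (Poly_Mapping.single \<alpha> c) x = c * monom_eval \<alpha> x"
  by (subst peval_superset[of "{\<alpha>}"]) (auto)

lemma peval_Const [simp]: "peval (Const c) x = c"
  by (simp add: Const_def)

lemma peval_Var [simp]: "peval (Var i) x = x $ i"
  by (simp add: Var_def monom_eval_def lookup_single when_def power_0 if_distrib prod.delta cong: if_cong)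

lemma peval_add [simp]: "peval (p + q) x = peval p x + peval q x"
proof -
  let ?S = "Poly_Mapping.keys p \<union> Poly_Mapping.keys q"
  show ?thesis
    using keys_add[of p q]
    by (simp add: peval_superset[of ?S] lookup_add distrib_right sum.distrib)
qed

lemma peval_sum [simp]: "peval (sum p A) x = (\<Sum>a\<in>A. peval (p a) x)"
  by (induction A rule: infinite_finite_induct) auto

lemma peval_mult [simp]: "peval (p * q) x = peval p x * peval q x"
proof -
  let ?t = "\<lambda>p. \<Sum>\<alpha>\<in>Poly_Mapping.keys p. Poly_Mapping.single \<alpha> (Poly_Mapping.lookup p \<alpha>)"
  have p: "p = ?t p" and q: "q = ?t q"
    by (rule sum_of_terms; simp)+
  have "peval (?t p * ?t q) x = peval (?t p) x * peval (?t q) x"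
    unfolding sum_product peval_sum by (simp add: mult_single monom_eval_add mult_ac)
  then show ?thesis
    by (simp only: p [symmetric] q [symmetric])
qed

lemma peval_1 [simp]: "peval 1 x = 1"
  by (metis peval_Const Const_def single_one)

lemma peval_uminus [simp]: "peval (- p) x = - peval p x"
  by (metis add.left_inverse add_eq_0_iff peval_0 peval_add)

lemma peval_diff [simp]: "peval (p - q) x = peval p x - peval q x"
  by (metis peval_add peval_uminus uminus_add_conv_diff add.commute)

lemma peval_power [simp]: "peval (p ^ k) x = peval p x ^ k"
  by (induction k) auto

lemma peval_prod [simp]: "peval (prod p A) x = (\<Prod>a\<in>A. peval (p a) x)"
  by (induction A rule: infinite_finite_induct) auto

section \<open>Partial derivatives\<close>

lemma monom_eval_derivative:
  fixes u v :: "real ^ 'n::finite"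
  shows "((\<lambda>t. monom_eval \<alpha> (u + t *\<^sub>R v)) has_real_derivative
     (\<Sum>i\<in>UNIV. v $ i * (real (Poly_Mapping.lookup \<alpha> i) *
        monom_eval (\<alpha> - Poly_Mapping.single i 1) (u + t *\<^sub>R v)))) (at t)"
proof -
  let ?w = "u + t *\<^sub>R v"
  have "((\<lambda>t. \<Prod>i\<in>UNIV. (u $ i + t * v $ i) ^ Poly_Mapping.lookup \<alpha> i) has_real_derivative
     (\<Sum>i\<in>UNIV. (real (Poly_Mapping.lookup \<alpha> i) * (u $ i + t * v $ i) ^ (Poly_Mapping.lookup \<alpha> i - 1) * v $ i) *
        (\<Prod>j\<in>UNIV - {i}. (u $ j + t * v $ j) ^ Poly_Mapping.lookup \<alpha> j))) (at t)"
  proof (rule has_field_derivative_prod)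
    fix i
    show "((\<lambda>t. (u $ i + t * v $ i) ^ Poly_Mapping.lookup \<alpha> i) has_real_derivative
       real (Poly_Mapping.lookup \<alpha> i) * (u $ i + t * v $ i) ^ (Poly_Mapping.lookup \<alpha> i - 1) * v $ i) (at t)"
      by (rule derivative_eq_intros refl)+ (simp add: mult_ac)
  qed
  moreover have "monom_eval (\<alpha> - Poly_Mapping.single i 1) ?w =
      (u $ i + t * v $ i) ^ (Poly_Mapping.lookup \<alpha> i - 1) *
      (\<Prod>j\<in>UNIV - {i}. (u $ j + t * v $ j) ^ Poly_Mapping.lookup \<alpha> j)" for i
    unfolding monom_eval_def
    by (subst prod.remove[of _ i]) (auto simp: lookup_minus lookup_single when_def intro!: arg_cong2[where f="(*)"] prod.cong)
  ultimately show ?thesis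
    by (simp add: monom_eval_def[of \<alpha>] mult_ac)
qed

text \<open>The coefficient form of differentiation: unlike the defining sum over the support, it makes linearity of
\<open>partial i\<close> immediate and lets the next lemmas read coefficients off from derivatives.\<close>

lemma lookup_partial:
  "Poly_Mapping.lookup (partial i p) \<beta> =
     real (Suc (Poly_Mapping.lookup \<beta> i)) * Poly_Mapping.lookup p (\<beta> + Poly_Mapping.single i 1)"
proof -
  let ?e = "Poly_Mapping.single i 1 :: 'a expo"
  have "(real (Poly_Mapping.lookup \<alpha> i) * Poly_Mapping.lookup p \<alpha> when \<alpha> - ?e = \<beta>) =
     (if \<alpha> = \<beta> + ?e then real (Suc (Poly_Mapping.lookup \<beta> i)) * Poly_Mapping.lookup p (\<beta> + ?e) else 0)" for \<alpha>
  proof (cases "Poly_Mapping.lookup \<alpha> i = 0")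
    case True
    then have "\<alpha> \<noteq> \<beta> + ?e" by (auto simp: lookup_add)
    with True show ?thesis by (simp add: when_def)
  next
    case False
    then have "\<alpha> - ?e = \<beta> \<longleftrightarrow> \<alpha> = \<beta> + ?e"
      by (auto simp: poly_mapping_eq_iff fun_eq_iff lookup_add lookup_minus lookup_single when_def) 
    then show ?thesis by (auto simp: when_def lookup_add)
  qed
  then show ?thesis
    unfolding partial_def by (simp add: lookup_sum lookup_single sum.delta in_keys_iff)
qed

text \<open>The chain rule along a line, for the formal partial derivatives.\<close>

lemma peval_derivative:
  fixes u v :: "real ^ 'n::finite"
  shows "((\<lambda>t. peval p (u + t *\<^sub>R v)) has_real_derivative
     (\<Sum>i\<in>UNIV. v $ i * peval (partial i p) (u + t *\<^sub>R v))) (at t)"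
proof -
  have "((\<lambda>t. \<Sum>\<alpha>\<in>Poly_Mapping.keys p. Poly_Mapping.lookup p \<alpha> * monom_eval \<alpha> (u + t *\<^sub>R v))
     has_real_derivative (\<Sum>\<alpha>\<in>Poly_Mapping.keys p. Poly_Mapping.lookup p \<alpha> *
       (\<Sum>i\<in>UNIV. v $ i * (real (Poly_Mapping.lookup \<alpha> i) *
        monom_eval (\<alpha> - Poly_Mapping.single i 1) (u + t *\<^sub>R v))))) (at t)"
    by (auto intro!: derivative_eq_intros monom_eval_derivative simp: algebra_simps)
  also have "(\<lambda>t. \<Sum>\<alpha>\<in>Poly_Mapping.keys p. Poly_Mapping.lookup p \<alpha> * monom_eval \<alpha> (u + t *\<^sub>R v)) =
     (\<lambda>t. peval p (u + t *\<^sub>R v))"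
    by (simp add: peval_superset[OF finite_keys order_refl])
  also have "(\<Sum>\<alpha>\<in>Poly_Mapping.keys p. Poly_Mapping.lookup p \<alpha> *
       (\<Sum>i\<in>UNIV. v $ i * (real (Poly_Mapping.lookup \<alpha> i) *
        monom_eval (\<alpha> - Poly_Mapping.single i 1) (u + t *\<^sub>R v)))) =
      (\<Sum>i\<in>UNIV. v $ i * peval (partial i p) (u + t *\<^sub>R v))"
    unfolding partial_def peval_sum peval_single sum_distrib_left
    by (subst sum.swap) (simp add: algebra_simps)
  finally show ?thesis .
qed

lemma lookup_0_eq_peval_0: "Poly_Mapping.lookup p 0 = peval p 0"
proof -
  have "peval p 0 = (\<Sum>\<alpha>\<in>insert 0 (Poly_Mapping.keys p). Poly_Mapping.lookup p \<alpha> * monom_eval \<alpha> 0)"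
    by (rule peval_superset) auto
  also have "\<dots> = Poly_Mapping.lookup p 0"
    by (subst sum.remove[of _ 0]) (auto simp: monom_eval_at_0)
  finally show ?thesis ..
qed

lemma peval_partial:
  "((\<lambda>t. peval p (x + t *\<^sub>R axis i 1)) has_real_derivative peval (partial i p) x) (at 0)"
proof -
  have "(\<Sum>j\<in>UNIV. axis i 1 $ j * peval (partial j p) (x + 0 *\<^sub>R axis i 1)) = peval (partial i p) x"
    by (simp add: axis_def if_distrib if_distribR cong: if_cong)
  then show ?thesis using peval_derivative[of p x "axis i 1" 0] by simp
qed

lemma peval_partial_zero:
  assumes "\<And>x. peval p x = 0"
  shows "peval (partial i p) x = 0"
  using DERIV_unique[OF peval_partial[of p x i, unfolded assms] DERIV_const] .

text \<open>A polynomial that vanishes identically has vanishing derivatives, and its coefficient at \<open>\<alpha>\<close> is, up to the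
factor $\alpha!$, the value at the origin of the derivative of order \<open>\<alpha>\<close>. Differentiating once in a variable that
occurs in \<open>\<alpha>\<close> therefore gives an induction on the total degree of \<open>\<alpha>\<close>. As a consequence, polynomial identities
below are proved pointwise.\<close>

lemma peval_zero_imp_zero:
  assumes "\<And>x. peval p x = 0"
  shows "p = 0"
proof (rule poly_mapping_eqI)
  fix \<alpha>
  have "Poly_Mapping.lookup p \<alpha> = 0"
    using assms
  proof (induction "\<Sum>i\<in>UNIV. Poly_Mapping.lookup \<alpha> i" arbitrary: p \<alpha>)
    case 0
    then have "\<alpha> = 0" by (intro poly_mapping_eqI) simp
    with 0 show ?case by (simp add: lookup_0_eq_peval_0)
  next
    case (Suc k)
    then obtain i where i: "Poly_Mapping.lookup \<alpha> i \<noteq> 0"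
      by (metis Zero_neq_Suc sum.neutral)
    let ?e = "Poly_Mapping.single i 1 :: 'a expo"
    define \<beta> where "\<beta> = \<alpha> - ?e"
    have \<alpha>: "\<alpha> = \<beta> + ?e"
      using i by (auto simp: \<beta>_def poly_mapping_eq_iff fun_eq_iff lookup_add lookup_minus lookup_single when_def)
    have "k = (\<Sum>i\<in>UNIV. Poly_Mapping.lookup \<beta> i)"
      using Suc.hyps(2) by (simp add: \<alpha> lookup_add sum.distrib lookup_single when_def)
    from Suc.hyps(1)[OF this peval_partial_zero, of p i] Suc.prems
    show ?case by (simp add: lookup_partial \<alpha>)
  qed
  then show "Poly_Mapping.lookup p \<alpha> = Poly_Mapping.lookup 0 \<alpha>" by simp
qed

lemma peval_inject:
  assumes "\<And>x. peval p x = peval q x"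
  shows "p = q"
  using peval_zero_imp_zero[of "p - q"] assms by simp

section \<open>Sums of squares and positive semidefinite forms\<close>

lemma sos_0 [simp]: "sos 0"
  unfolding sos_def by (intro exI[of _ 0]) simp

lemma sos_square: "sos (p ^ 2)"
  unfolding sos_def by (intro exI[of _ 1] exI[of _ "\<lambda>_. p"]) simp

lemma sos_add: 
  assumes "sos p" "sos q" shows "sos (p + q)"
proof -
  obtain r u s v where p: "p = (\<Sum>k<(r::nat). u k ^ 2)" and q: "q = (\<Sum>k<(s::nat). v k ^ 2)"
    using assms by (auto simp: sos_def)
  let ?w = "\<lambda>k. if k < r then u k else v (k - r)"
  have "(\<Sum>k<r + s. ?w k ^ 2) = (\<Sum>k<r. ?w k ^ 2) + (\<Sum>k=r..<r + s. ?w k ^ 2)"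
    unfolding lessThan_atLeast0 by (rule sum.atLeastLessThan_concat [symmetric]) auto
  also have "(\<Sum>k=r..<r + s. ?w k ^ 2) = (\<Sum>k<s. v k ^ 2)"
    using sum.shift_bounds_nat_ivl[of "\<lambda>k. ?w k ^ 2" 0 r s] by (simp add: lessThan_atLeast0 add.commute)
  also have "(\<Sum>k<r. ?w k ^ 2) = (\<Sum>k<r. u k ^ 2)" by simp
  finally have "p + q = (\<Sum>k<r + s. ?w k ^ 2)" unfolding p q ..
  then show ?thesis unfolding sos_def by (intro exI[of _ "r + s"] exI[of _ ?w])
qed

lemma sos_sum: "(\<And>a. a \<in> A \<Longrightarrow> sos (p a)) \<Longrightarrow> sos (sum p A)"
  by (induction A rule: infinite_finite_induct) (auto intro: sos_add)

lemma Const_mult: "Const a * Const b = Const (a * b)"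
  by (simp add: Const_def mult_single)

lemma lookup_Const_mult [simp]: "Poly_Mapping.lookup (Const c * p) \<alpha> = c * Poly_Mapping.lookup p \<alpha>"
  by (simp add: Const_def mult_map_scale_conv_mult [symmetric] Poly_Mapping.map.rep_eq when_def)

lemma Const_0 [simp]: "Const 0 = 0"
  by (simp add: Const_def)

lemma Const_1 [simp]: "Const 1 = 1"
  by (simp add: Const_def)

lemma sos_Const_mult:
  fixes p :: "'n rpoly"
  assumes "sos p" "c \<ge> 0" shows "sos (Const c * p)"
proof -
  obtain r u where p: "p = (\<Sum>k<(r::nat). u k ^ 2)" using assms by (auto simp: sos_def)
  have "Const c = (Const (sqrt c) ^ 2 :: 'n rpoly)" using assms by (simp add: power2_eq_square Const_mult)
  then have "Const c * p = (\<Sum>k<r. (Const (sqrt c) * u k) ^ 2)"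
    by (simp add: p power_mult_distrib flip: sum_distrib_left)
  then show ?thesis
    unfolding sos_def by (intro exI[of _ r] exI[of _ "\<lambda>k. Const (sqrt c) * u k"])
qed

lemma sos_Const: "c \<ge> 0 \<Longrightarrow> sos (Const c)"
  using sos_Const_mult[OF sos_square[of 1], of c] by simp

text \<open>The next two identities are one step of completing the square. They are stated over an arbitrary commutative ring
because they are applied twice: to real vectors and to tuples of polynomials.\<close>

lemma quad_form_insert:
  fixes M :: "'i \<Rightarrow> 'i \<Rightarrow> 'a::comm_ring_1"
  assumes "finite I" "i \<notin> I" "\<And>a. a \<in> I \<Longrightarrow> M a i = M i a"
  shows "(\<Sum>a\<in>insert i I. \<Sum>b\<in>insert i I. g a * M a b * g b) =
    M i i * g i ^ 2 + 2 * g i * (\<Sum>b\<in>I. M i b * g b) + (\<Sum>a\<in>I. \<Sum>b\<in>I. g a * M a b * g b)"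
proof -
  have "(\<Sum>a\<in>I. g a * M a i * g i) = g i * (\<Sum>b\<in>I. M i b * g b)"
    unfolding sum_distrib_left by (rule sum.cong) (auto simp: assms(3) mult_ac)
  moreover have "(\<Sum>b\<in>I. g i * M i b * g b) = g i * (\<Sum>b\<in>I. M i b * g b)"
    unfolding sum_distrib_left by (rule sum.cong) (auto simp: mult_ac)
  ultimately have "(\<Sum>a\<in>insert i I. \<Sum>b\<in>insert i I. g a * M a b * g b) =
     g i * M i i * g i + g i * (\<Sum>b\<in>I. M i b * g b) +
     (g i * (\<Sum>b\<in>I. M i b * g b) + (\<Sum>a\<in>I. \<Sum>b\<in>I. g a * M a b * g b))"
    by (simp only: sum.insert[OF assms(1,2)] sum.distrib)
  then show ?thesis by (simp add: power2_eq_square algebra_simps)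
qed

lemma quad_form_schur_complement:
  fixes M :: "'i \<Rightarrow> 'i \<Rightarrow> 'a::comm_ring_1"
  assumes "\<And>a. a \<in> I \<Longrightarrow> M a i = M i a"
  shows "(\<Sum>a\<in>I. \<Sum>b\<in>I. g a * (M a b - c * M a i * M i b) * g b) =
     (\<Sum>a\<in>I. \<Sum>b\<in>I. g a * M a b * g b) - c * (\<Sum>b\<in>I. M i b * g b) ^ 2"
proof -
  have "(\<Sum>b\<in>I. M i b * g b) ^ 2 = (\<Sum>a\<in>I. \<Sum>b\<in>I. g a * (M a i * M i b) * g b)"
    unfolding power2_eq_square sum_product
    by (intro sum.cong refl) (simp add: assms mult_ac)
  then show ?thesis
    by (simp add: sum_distrib_left sum_subtractf [symmetric] algebra_simps)
qed

lemma psd_on_sym: "psd_on I M \<Longrightarrow> a \<in> I \<Longrightarrow> b \<in> I \<Longrightarrow> M a b = M b a"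
  unfolding psd_on_def by blast

lemma psd_on_subset:
  assumes "psd_on I M" "J \<subseteq> I" "finite I"
  shows "psd_on J M"
  unfolding psd_on_def
proof (intro conjI ballI allI)
  fix v :: "'a \<Rightarrow> real"
  let ?v = "\<lambda>a. if a \<in> J then v a else 0"
  have "0 \<le> (\<Sum>a\<in>I. \<Sum>b\<in>I. ?v a * M a b * ?v b)"
    using assms by (simp add: psd_on_def)
  also have "\<dots> = (\<Sum>a\<in>J. \<Sum>b\<in>J. v a * M a b * v b)"
    using assms(2,3) by (intro sum.mono_neutral_cong_right) (auto intro!: sum.mono_neutral_cong_right)
  finally show "0 \<le> (\<Sum>a\<in>J. \<Sum>b\<in>J. v a * M a b * v b)" .
qed (use assms in \<open>auto simp: psd_on_def\<close>)

lemma psd_on_diag: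
  assumes "psd_on I M" "finite I" "i \<in> I"
  shows "0 \<le> M i i"
proof -
  have "psd_on {i} M" using assms by (intro psd_on_subset[OF assms(1)]) auto
  then have "0 \<le> (\<Sum>a\<in>{i}. \<Sum>b\<in>{i}. v a * M a b * v b)" for v
    by (simp add: psd_on_def)
  from this[of "\<lambda>_. 1"] show ?thesis by simp
qed

text \<open>With a zero on the diagonal, the restriction of the form to $\{i,a\}$ is affine in the coordinate at \<open>i\<close>, and an
affine function that is bounded below is constant.\<close>

lemma psd_on_zero_diag:
  assumes "psd_on I M" "finite I" "i \<in> I" "a \<in> I" "M i i = 0"
  shows "M i a = 0"
proof (rule ccontr)
  assume nz: "M i a \<noteq> 0"
  then have ne: "i \<noteq> a" using assms by auto
  have "psd_on {i, a} M" using assms by (intro psd_on_subset[OF assms(1)]) auto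
  then have "0 \<le> (\<Sum>b\<in>{i, a}. \<Sum>c\<in>{i, a}. v b * M b c * v c)" for v
    by (simp add: psd_on_def)
  from this[of "\<lambda>b. if b = i then s else 1" for s]
  have "0 \<le> s * M i a + s * M a i + M a a" for s
    using ne assms(5) by (simp add: mult.commute add.assoc)
  from this[of "- (M a a + 1) / (2 * M i a)"]
  have "0 \<le> - (M a a + 1) / (2 * M i a) * M i a + - (M a a + 1) / (2 * M i a) * M a i + M a a" .
  moreover have "M a i = M i a" using psd_on_sym assms(1,3,4) by metis
  moreover have "- (M a a + 1) / (2 * M i a) * M i a = - (M a a + 1) / 2"
    using nz by simp
  ultimately show False by simp
qed

text \<open>Diagonalization by completing squares (a Cholesky factorization carried out on the polynomials): splitting off index
\<open>i\<close> contributes one square with the nonnegative weight \<open>M i i\<close> and leaves the Schur complement, which is positive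
semidefinite on the remaining indices. If \<open>M i i = 0\<close>, then the convention \<open>inverse 0 = 0\<close> makes the Schur complement
equal to \<open>M\<close>, and the row of \<open>i\<close> vanishes, so that the same formulas cover both cases.\<close>

lemma sos_psd_form:
  fixes g :: "'i \<Rightarrow> 'n rpoly"
  assumes "finite I" "psd_on I M"
  shows "sos (\<Sum>a\<in>I. \<Sum>b\<in>I. g a * Const (M a b) * g b)"
  using assms
proof (induction I arbitrary: M rule: finite_induct)
  case (insert i I)
  let ?m = "M i i"
  have sym: "M a i = M i a" if "a \<in> I" for a
    using that by (intro psd_on_sym[OF insert.prems]) auto
  have m0: "?m \<ge> 0"
    using psd_on_diag[OF insert.prems] insert.hyps by simp
  have z: "?m = 0 \<Longrightarrow> a \<in> I \<Longrightarrow> M i a = 0" for a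
    using psd_on_zero_diag[OF insert.prems] insert.hyps by simp
  define M' where "M' a b = M a b - inverse ?m * M a i * M i b" for a b
  have "psd_on I M'"
    unfolding psd_on_def
  proof (intro conjI ballI allI)
    show "M' a b = M' b a" if "a \<in> I" "b \<in> I" for a b
      using psd_on_sym[OF insert.prems, of a b] sym that by (simp add: M'_def mult_ac)
    fix v :: "'i \<Rightarrow> real"
    let ?s = "\<Sum>b\<in>I. M i b * v b"
    \<comment> \<open>the coordinate at \<open>i\<close> that minimizes the form of \<open>M\<close> for the given other coordinates\<close>
    let ?v = "v(i := - inverse ?m * ?s)"
    have vI: "?v a = v a" if "a \<in> I" for a
      using that insert.hyps by auto
    have "0 \<le> (\<Sum>a\<in>insert i I. \<Sum>b\<in>insert i I. ?v a * M a b * ?v b)"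
      using insert.prems unfolding psd_on_def by blast
    also have "\<dots> = ?m * ?v i ^ 2 + 2 * ?v i * (\<Sum>b\<in>I. M i b * ?v b) + (\<Sum>a\<in>I. \<Sum>b\<in>I. ?v a * M a b * ?v b)"
      by (rule quad_form_insert) (use insert.hyps sym in auto)
    also have "(\<Sum>b\<in>I. M i b * ?v b) = ?s"
      by (intro sum.cong refl) (simp only: vI)
    also have "(\<Sum>a\<in>I. \<Sum>b\<in>I. ?v a * M a b * ?v b) = (\<Sum>a\<in>I. \<Sum>b\<in>I. v a * M a b * v b)"
      by (intro sum.cong refl) (simp only: vI)
    also have "?m * ?v i ^ 2 + 2 * ?v i * ?s + (\<Sum>a\<in>I. \<Sum>b\<in>I. v a * M a b * v b) =
       (\<Sum>a\<in>I. \<Sum>b\<in>I. v a * M a b * v b) - inverse ?m * ?s ^ 2"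
    proof -
      have "?m * (- inverse ?m * s) ^ 2 + 2 * (- inverse ?m * s) * s = - inverse ?m * s ^ 2" for s
        by (cases "?m = 0") (simp_all add: power2_eq_square field_simps)
      from this[of ?s] show ?thesis by simp
    qed
    also have "\<dots> = (\<Sum>a\<in>I. \<Sum>b\<in>I. v a * M' a b * v b)"
      unfolding M'_def by (rule quad_form_schur_complement[symmetric]) (use sym in auto)
    finally show "0 \<le> (\<Sum>a\<in>I. \<Sum>b\<in>I. v a * M' a b * v b)" .
  qed
  then have IH: "sos (\<Sum>a\<in>I. \<Sum>b\<in>I. g a * Const (M' a b) * g b)"
    by (rule insert.IH)
  let ?S = "\<Sum>b\<in>I. Const (M i b) * g b"
  have C: "Const (M' a b) = Const (M a b) - Const (inverse ?m) * Const (M a i) * Const (M i b)" for a b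
    unfolding M'_def by (simp add: Const_mult) (simp add: Const_def single_diff)
  have 1: "(\<Sum>a\<in>I. \<Sum>b\<in>I. g a * Const (M' a b) * g b) =
     (\<Sum>a\<in>I. \<Sum>b\<in>I. g a * Const (M a b) * g b) - Const (inverse ?m) * ?S ^ 2"
    unfolding C by (rule quad_form_schur_complement) (use sym in auto)
  have 2: "(\<Sum>a\<in>insert i I. \<Sum>b\<in>insert i I. g a * Const (M a b) * g b) =
      Const ?m * g i ^ 2 + 2 * g i * ?S + (\<Sum>a\<in>I. \<Sum>b\<in>I. g a * Const (M a b) * g b)"
    by (rule quad_form_insert) (use insert.hyps sym in auto)
  have 3: "Const ?m * g i ^ 2 + 2 * g i * ?S + Const (inverse ?m) * ?S ^ 2 =
      Const ?m * (g i + Const (inverse ?m) * ?S) ^ 2"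
  proof (cases "?m = 0")
    case True
    then have "?S = 0" using z by (intro sum.neutral) auto
    with True show ?thesis by simp
  next
    case False
    then have 1: "Const ?m * Const (inverse ?m) = 1" by (simp add: Const_mult)
    have "Const ?m * (g i + Const (inverse ?m) * ?S) ^ 2 = Const ?m * g i ^ 2 + 2 * g i * (Const ?m * Const (inverse ?m)) * ?S
       + (Const ?m * Const (inverse ?m)) * Const (inverse ?m) * ?S ^ 2"
      by (simp add: power2_eq_square algebra_simps)
    then show ?thesis unfolding 1 by simp
  qed
  have "(\<Sum>a\<in>insert i I. \<Sum>b\<in>insert i I. g a * Const (M a b) * g b) =
     Const ?m * (g i + Const (inverse ?m) * ?S) ^ 2 + (\<Sum>a\<in>I. \<Sum>b\<in>I. g a * Const (M' a b) * g b)"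
    unfolding 1 2 3 [symmetric] by simp
  then show ?case
    by (simp only: sos_add sos_Const_mult sos_square m0 IH)
qed simp

section \<open>The tangent remainder of an SOS-convex polynomial\<close>

text \<open>The second-order Taylor inequality, by two applications of the monotonicity criterion.\<close>

lemma convex_tangent_01:
  fixes \<phi> :: "real \<Rightarrow> real"
  assumes "\<And>t. (\<phi> has_real_derivative \<phi>' t) (at t)"
    and "\<And>t. (\<phi>' has_real_derivative \<phi>'' t) (at t)"
    and "\<And>t. \<phi>'' t \<ge> 0"
  shows "\<phi> 0 + \<phi>' 0 \<le> \<phi> 1"
proof -
  have "\<phi>' 0 \<le> \<phi>' t" if "0 \<le> t" for t
    using assms(2,3) by (intro DERIV_nonneg_imp_nondecreasing[OF that]) blast
  then have "\<phi> 0 - \<phi>' 0 * 0 \<le> \<phi> 1 - \<phi>' 0 * 1"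
  proof (intro DERIV_nonneg_imp_nondecreasing[where f="\<lambda>t. \<phi> t - \<phi>' 0 * t"])
    fix t :: real assume "0 \<le> t"
    have "((\<lambda>t. \<phi> t - \<phi>' 0 * t) has_real_derivative \<phi>' t - \<phi>' 0 * 1) (at t)"
      by (intro DERIV_diff DERIV_cmult DERIV_ident assms(1))
    then show "\<exists>y. ((\<lambda>t. \<phi> t - \<phi>' 0 * t) has_real_derivative y) (at t) \<and> 0 \<le> y"
      using \<open>\<And>t. 0 \<le> t \<Longrightarrow> \<phi>' 0 \<le> \<phi>' t\<close>[OF \<open>0 \<le> t\<close>] by force
  qed simp
  then show ?thesis by simp
qed

text \<open>The remainder $\varphi(1)-\varphi(0)-\varphi'(0)$ depends only on $\varphi''$; this takes the place of its integral formula.\<close>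

lemma taylor_unique_01:
  fixes \<phi> \<psi> :: "real \<Rightarrow> real"
  assumes "\<And>t. (\<phi> has_real_derivative \<phi>' t) (at t)" "\<And>t. (\<phi>' has_real_derivative \<omega> t) (at t)"
    and "\<And>t. (\<psi> has_real_derivative \<psi>' t) (at t)" "\<And>t. (\<psi>' has_real_derivative \<omega> t) (at t)"
  shows "\<phi> 1 - \<phi> 0 - \<phi>' 0 = \<psi> 1 - \<psi> 0 - \<psi>' 0"
  using convex_tangent_01[OF DERIV_diff[OF assms(1,3)] DERIV_diff[OF assms(2,4)]]
    convex_tangent_01[OF DERIV_diff[OF assms(3,1)] DERIV_diff[OF assms(4,2)]]
  by simp

text \<open>The number $\int_0^1 (1-t)\, t^{a+b}\, dt$, by which the product of the coefficients of $t^a$ and $t^b$ enters the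
integral Taylor remainder of a square.\<close>

definition taylor_weight :: "nat \<Rightarrow> nat \<Rightarrow> real" where
  "taylor_weight a b = 1 / ((a + b + 1) * (a + b + 2))"

text \<open>Twice integrated, the square of a polynomial in \<open>t\<close> with coefficients \<open>v\<close> becomes at $t=1$ the quadratic form of
\<open>taylor_weight\<close>. This gives both positive semidefiniteness of the weights and the Taylor remainder below.\<close>

lemma square_antiderivatives:
  fixes v :: "nat \<Rightarrow> real" and A :: "nat set"
  defines "\<Phi> \<equiv> \<lambda>t. \<Sum>a\<in>A. \<Sum>b\<in>A. v a * taylor_weight a b * v b * t ^ (a + b + 2)"
    and "\<Phi>' \<equiv> \<lambda>t. \<Sum>a\<in>A. \<Sum>b\<in>A. v a * v b / (a + b + 1) * t ^ (a + b + 1)"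
  shows "(\<Phi> has_real_derivative \<Phi>' t) (at t)"
    and "(\<Phi>' has_real_derivative (\<Sum>a\<in>A. v a * t ^ a) ^ 2) (at t)"
proof -
  have [simp]: "real a + real b + 2 \<noteq> 0" "real a + real b + 1 \<noteq> 0" for a b by linarith+
  have "((\<lambda>t. v a * taylor_weight a b * v b * t ^ (a + b + 2)) has_real_derivative
      v a * v b / (a + b + 1) * t ^ (a + b + 1)) (at t)" for a b
    by (rule derivative_eq_intros refl)+ (simp add: taylor_weight_def divide_simps, simp add: algebra_simps)
  then show "(\<Phi> has_real_derivative \<Phi>' t) (at t)"
    unfolding \<Phi>_def \<Phi>'_def by (intro DERIV_sum)
  have "((\<lambda>t. v a * v b / (a + b + 1) * t ^ (a + b + 1)) has_real_derivative
      v a * t ^ a * (v b * t ^ b)) (at t)" for a b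
    by (rule derivative_eq_intros refl)+ (simp add: divide_simps power_add)
  then show "(\<Phi>' has_real_derivative (\<Sum>a\<in>A. v a * t ^ a) ^ 2) (at t)"
    unfolding power2_eq_square sum_product \<Phi>'_def by (intro DERIV_sum)
qed

lemma psd_taylor_weight: "psd_on A taylor_weight"
  unfolding psd_on_def
proof (intro conjI ballI allI)
  fix v :: "nat \<Rightarrow> real"
  show "0 \<le> (\<Sum>a\<in>A. \<Sum>b\<in>A. v a * taylor_weight a b * v b)"
    using convex_tangent_01[OF square_antiderivatives[of v A]] by simp
qed (simp add: taylor_weight_def add.commute)

text \<open>The polynomial obtained by substituting the point at parameter \<open>t\<close> of the line from \<open>u\<close> to \<open>x\<close> for the
variables, expanded in powers of \<open>t\<close>: its coefficients are polynomials in \<open>x\<close>.\<close>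

definition line_subst :: "real ^ 'n \<Rightarrow> 'n::finite rpoly \<Rightarrow> 'n rpoly poly" where
  "line_subst u p = (\<Sum>\<alpha>\<in>Poly_Mapping.keys p. smult (Const (Poly_Mapping.lookup p \<alpha>))
     (\<Prod>i\<in>UNIV. [:Const (u $ i), Var i - Const (u $ i):] ^ Poly_Mapping.lookup \<alpha> i))"

lemma peval_line_subst:
  "peval (poly (line_subst u p) (Const t)) x = peval p (u + t *\<^sub>R (x - u))"
  unfolding line_subst_def peval_superset[OF finite_keys order_refl, of p] monom_eval_def
  by (simp add: poly_sum poly_prod)

definition tangent_remainder :: "'n::finite rpoly \<Rightarrow> real ^ 'n \<Rightarrow> 'n rpoly" where
  "tangent_remainder q u =
     q - Const (peval q u) - (\<Sum>i\<in>UNIV. Const (peval (partial i q) u) * (Var i - Const (u $ i)))"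

lemma peval_tangent_remainder:
  "peval (tangent_remainder q u) x =
     peval q x - peval q u - (\<Sum>i\<in>UNIV. (x - u) $ i * peval (partial i q) u)"
  by (simp add: tangent_remainder_def mult.commute)

text \<open>The Taylor remainder is $\int_0^1 (1-t)\,(x-u)^T\nabla^2q(u+t(x-u))(x-u)\,dt$, and SOS-convexity makes the quadratic
form in it the sum over the columns of \<open>F\<close> of the squares of $\sum_i (x_i-u_i)F_{ik}(u+t(x-u))$. Expanding each of
these in powers of $t$ and integrating termwise leaves the positive semidefinite form \<open>taylor_weight\<close> in
the coefficients, which are polynomials in $x$; hence a sum of squares.\<close>

lemma sos_convex_tangent_remainder:
  fixes q :: "'n::finite rpoly"
  assumes "sos_convex q"
  shows "sos (tangent_remainder q u)"
proof -
  obtain P and F :: "'n \<Rightarrow> nat \<Rightarrow> 'n rpoly"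
    where F: "\<And>i j. hessian q i j = (\<Sum>k<P. F i k * F j k)"
    using assms by (auto simp: sos_convex_def)
  define G where "G k = (\<Sum>i\<in>UNIV. smult (Var i - Const (u $ i)) (line_subst u (F i k)))" for k
  define N where "N = Max (insert 0 ((\<lambda>k. degree (G k)) ` {..<P}))"
  define R where "R = (\<Sum>k<P. \<Sum>a\<le>N. \<Sum>b\<le>N. coeff (G k) a * Const (taylor_weight a b) * coeff (G k) b)"
  have "sos R"
    unfolding R_def by (intro sos_sum sos_psd_form psd_taylor_weight) auto
  moreover have "tangent_remainder q u = R"
  proof (rule peval_inject)
    fix x
    define v where "v = x - u"
    define g where "g k a = peval (coeff (G k) a) x" for k a
    have G: "(\<Sum>i\<in>UNIV. v $ i * peval (F i k) (u + t *\<^sub>R v)) = (\<Sum>a\<le>N. g k a * t ^ a)"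
      if k: "k < P" for k t
    proof -
      have "degree (G k) \<le> N" using k by (auto simp: N_def intro!: Max_ge)
      then have "poly (G k) (Const t) = (\<Sum>a\<le>N. coeff (G k) a * Const t ^ a)"
        unfolding poly_altdef by (intro sum.mono_neutral_left) (auto simp: coeff_eq_0)
      then have "peval (poly (G k) (Const t)) x = (\<Sum>a\<le>N. g k a * t ^ a)"
        by (simp add: g_def)
      then show ?thesis
        unfolding G_def by (simp add: poly_sum peval_line_subst v_def)
    qed
    let ?\<phi> = "\<lambda>t. peval q (u + t *\<^sub>R v)"
    let ?\<phi>' = "\<lambda>t. \<Sum>i\<in>UNIV. v $ i * peval (partial i q) (u + t *\<^sub>R v)"
    let ?\<omega> = "\<lambda>t. \<Sum>k<P. (\<Sum>a\<le>N. g k a * t ^ a) ^ 2"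
    let ?\<Phi> = "\<lambda>t. \<Sum>k<P. \<Sum>a\<le>N. \<Sum>b\<le>N. g k a * taylor_weight a b * g k b * t ^ (a + b + 2)"
    let ?\<Phi>' = "\<lambda>t. \<Sum>k<P. \<Sum>a\<le>N. \<Sum>b\<le>N. g k a * g k b / (a + b + 1) * t ^ (a + b + 1)"
    have "?\<phi> 1 - ?\<phi> 0 - ?\<phi>' 0 = ?\<Phi> 1 - ?\<Phi> 0 - ?\<Phi>' 0"
    proof (rule taylor_unique_01)
      fix t
      show "(?\<phi> has_real_derivative ?\<phi>' t) (at t)" by (rule peval_derivative)
      show "(?\<Phi> has_real_derivative ?\<Phi>' t) (at t)"
        by (intro DERIV_sum square_antiderivatives)
      show "(?\<Phi>' has_real_derivative ?\<omega> t) (at t)"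
        by (intro DERIV_sum square_antiderivatives)
      let ?w = "u + t *\<^sub>R v"
      have "(?\<phi>' has_real_derivative (\<Sum>j\<in>UNIV. v $ j * (\<Sum>i\<in>UNIV. v $ i * peval (hessian q i j) ?w))) (at t)"
        unfolding hessian_def by (intro DERIV_sum DERIV_cmult peval_derivative)
      also have "(\<Sum>j\<in>UNIV. v $ j * (\<Sum>i\<in>UNIV. v $ i * peval (hessian q i j) ?w)) =
          (\<Sum>j\<in>UNIV. \<Sum>i\<in>UNIV. \<Sum>k<P. (v $ j * peval (F j k) ?w) * (v $ i * peval (F i k) ?w))"
        by (simp add: F sum_distrib_left mult_ac)
      also have "\<dots> = (\<Sum>j\<in>UNIV. \<Sum>k<P. \<Sum>i\<in>UNIV. (v $ j * peval (F j k) ?w) * (v $ i * peval (F i k) ?w))"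
        by (intro sum.cong refl sum.swap)
      also have "\<dots> = (\<Sum>k<P. \<Sum>j\<in>UNIV. \<Sum>i\<in>UNIV. (v $ j * peval (F j k) ?w) * (v $ i * peval (F i k) ?w))"
        by (rule sum.swap)
      also have "\<dots> = ?\<omega> t"
        by (intro sum.cong refl) (simp add: G[symmetric] power2_eq_square sum_product)
      finally show "(?\<phi>' has_real_derivative ?\<omega> t) (at t)" .
    qed
    then show "peval (tangent_remainder q u) x = peval R x"
      by (simp add: peval_tangent_remainder R_def g_def v_def)
  qed
  ultimately show ?thesis by simp
qed

text \<open>Linearity of the tangent remainder: it carries the sum-of-squares property of the remainders of
$f$, $-g$ and the $h_i$ over to every nonnegative combination of them.\<close>

lemma partial_add: "partial i (p + q) = partial i p + partial i q"
  by (rule poly_mapping_eqI) (simp add: lookup_partial lookup_add algebra_simps)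

lemma partial_Const_mult: "partial i (Const c * p) = Const c * partial i p"
  by (rule poly_mapping_eqI) (simp add: lookup_partial)

lemma tangent_remainder_add: "tangent_remainder (p + q) u = tangent_remainder p u + tangent_remainder q u"
proof (rule peval_inject)
  fix x
  have "(\<Sum>i\<in>UNIV. (x - u) $ i * peval (partial i (p + q)) u) =
     (\<Sum>i\<in>UNIV. (x - u) $ i * peval (partial i p) u) + (\<Sum>i\<in>UNIV. (x - u) $ i * peval (partial i q) u)"
    by (simp only: partial_add peval_add distrib_left sum.distrib)
  then show "peval (tangent_remainder (p + q) u) x = peval (tangent_remainder p u + tangent_remainder q u) x"
    by (simp add: peval_tangent_remainder)
qed

lemma tangent_remainder_Const_mult: "tangent_remainder (Const c * p) u = Const c * tangent_remainder p u"
proof (rule peval_inject)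
  fix x
  have "(\<Sum>i\<in>UNIV. (x - u) $ i * peval (partial i (Const c * p)) u) =
     c * (\<Sum>i\<in>UNIV. (x - u) $ i * peval (partial i p) u)"
    by (simp only: partial_Const_mult peval_mult peval_Const sum_distrib_left mult.left_commute)
  then show "peval (tangent_remainder (Const c * p) u) x = peval (Const c * tangent_remainder p u) x"
    by (simp only: peval_tangent_remainder peval_mult peval_Const right_diff_distrib)
qed

lemma tangent_remainder_0 [simp]: "tangent_remainder 0 u = 0"
  using tangent_remainder_Const_mult[of 0 0 u] by simp

lemma tangent_remainder_sum: "tangent_remainder (sum p A) u = (\<Sum>a\<in>A. tangent_remainder (p a) u)"
  by (induction A rule: infinite_finite_induct) (auto simp: tangent_remainder_add)


section \<open>Convexity and Lagrange multipliers\<close>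

lemma sos_peval_nonneg: "sos p \<Longrightarrow> 0 \<le> peval p x"
  by (auto simp: sos_def intro!: sum_nonneg)

text \<open>The graph lies above each of its tangent hyperplanes; use the one at the intermediate point.\<close>

lemma convex_on_of_tangent_remainder:
  assumes "\<And>u. sos (tangent_remainder q u)"
  shows "convex_on UNIV (peval q)"
proof (rule convex_onI)
  fix t :: real and x y :: "real ^ 'a"
  assume t: "0 < t" "t < 1"
  define z where "z = (1 - t) *\<^sub>R x + t *\<^sub>R y"
  let ?g = "\<lambda>x. \<Sum>i\<in>UNIV. (x - z) $ i * peval (partial i q) z"
  have le: "peval q z + ?g w \<le> peval q w" for w
    using sos_peval_nonneg[OF assms, of z w] by (simp add: peval_tangent_remainder)
  have "(1 - t) * ?g x + t * ?g y = (\<Sum>i\<in>UNIV. ((1 - t) * (x - z) $ i + t * (y - z) $ i) * peval (partial i q) z)"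
    by (simp add: sum_distrib_left sum.distrib distrib_right mult.assoc)
  also have "\<dots> = 0"
    by (intro sum.neutral) (simp add: z_def algebra_simps)
  finally have "(1 - t) * (peval q z + ?g x) + t * (peval q z + ?g y) = peval q z"
    by (simp add: algebra_simps)
  moreover have "(1 - t) * (peval q z + ?g x) \<le> (1 - t) * peval q x" "t * (peval q z + ?g y) \<le> t * peval q y"
    using t le by (auto intro!: mult_left_mono)
  ultimately show "peval q ((1 - t) *\<^sub>R x + t *\<^sub>R y) \<le> (1 - t) * peval q x + t * peval q y"
    unfolding z_def by linarith
qed auto

text \<open>For one constraint, \<open>c\<close> must dominate the slopes \<open>- \<phi> x / \<eta> x\<close> at the points with \<open>\<eta> x > 0\<close> and stay below the
slopes \<open>\<phi> y / - \<eta> y\<close> at those with \<open>\<eta> y < 0\<close>. Each of the former is at most each of the latter: the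
segment from \<open>x\<close> to \<open>y\<close> contains a point at which the linear interpolation of \<open>\<eta>\<close> vanishes; by convexity \<open>\<eta>\<close>
is at most 0 there, so \<open>\<phi>\<close> is nonnegative there and so is its interpolation. The Slater point makes the supremum of the former finite.\<close>

lemma lagrange_multiplier:
  fixes \<phi> \<eta> :: "'a::real_vector \<Rightarrow> real"
  assumes \<phi>: "convex_on C \<phi>" and \<eta>: "convex_on C \<eta>"
    and slater: "xhat \<in> C" "\<eta> xhat < 0"
    and nonneg: "\<And>x. x \<in> C \<Longrightarrow> \<eta> x \<le> 0 \<Longrightarrow> 0 \<le> \<phi> x"
  shows "\<exists>c\<ge>0. \<forall>x\<in>C. 0 \<le> \<phi> x + c * \<eta> x"
proof -
  have C: "convex C" using \<phi> by (rule convex_on_imp_convex)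
  have key: "- \<phi> x / \<eta> x \<le> \<phi> y / - \<eta> y"
    if x: "x \<in> C" "\<eta> x > 0" and y: "y \<in> C" "\<eta> y < 0" for x y
  proof -
    define b where "b = \<eta> x / (\<eta> x - \<eta> y)"
    have b: "0 \<le> b" "b \<le> 1" and b1: "1 - b = - \<eta> y / (\<eta> x - \<eta> y)"
      using x y by (auto simp: b_def field_simps)
    let ?z = "(1 - b) *\<^sub>R x + b *\<^sub>R y"
    have "\<eta> ?z \<le> (1 - b) * \<eta> x + b * \<eta> y"
      using convex_onD[OF \<eta> b x(1) y(1)] .
    also have "\<dots> = 0" unfolding b1 using x y by (simp add: b_def field_simps)
    finally have "0 \<le> \<phi> ?z"
      using nonneg convexD_alt[OF C x(1) y(1) b] by simp
    also have "\<dots> \<le> (1 - b) * \<phi> x + b * \<phi> y"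
      using convex_onD[OF \<phi> b x(1) y(1)] .
    also have "\<dots> = (- \<eta> y * \<phi> x + \<eta> x * \<phi> y) / (\<eta> x - \<eta> y)"
      unfolding b1 by (simp add: b_def diff_divide_distrib)
    finally have "0 \<le> - \<eta> y * \<phi> x + \<eta> x * \<phi> y"
      using x y by (simp add: zero_le_divide_iff)
    then show ?thesis using x y by (simp add: field_simps)
  qed
  define S where "S = insert 0 ((\<lambda>x. - \<phi> x / \<eta> x) ` {x \<in> C. \<eta> x > 0})"
  have ub: "s \<le> \<phi> y / - \<eta> y" if "s \<in> S" "y \<in> C" "\<eta> y < 0" for s y
  proof (cases "s = 0")
    case True
    then show ?thesis using nonneg[of y] that by (simp add: divide_nonneg_neg)
  next
    case False
    then show ?thesis using that key by (auto simp: S_def)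
  qed
  have bdd: "bdd_above S" using ub[OF _ slater] by (auto simp: bdd_above_def)
  define c where "c = Sup S"
  have upper: "s \<le> c" if "s \<in> S" for s using bdd that by (simp add: c_def cSup_upper)
  have "0 \<le> \<phi> x + c * \<eta> x" if x: "x \<in> C" for x
  proof (cases "\<eta> x" "0::real" rule: linorder_cases)
    case less
    then have "c \<le> \<phi> x / - \<eta> x"
      unfolding c_def using ub[OF _ x] by (intro cSup_least) (auto simp: S_def)
    then show ?thesis using less by (simp add: field_simps)
  next
    case equal
    then show ?thesis using nonneg x by simp
  next
    case greater
    then have "- \<phi> x / \<eta> x \<le> c" using x by (intro upper) (auto simp: S_def)
    then show ?thesis using greater by (simp add: field_simps)
  qed
  then show ?thesis using upper[of 0] by (auto simp: S_def)
qed

lemma convex_sublevel: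
  fixes \<eta> :: "'a::real_vector \<Rightarrow> real"
  assumes "convex_on UNIV \<eta>"
  shows "convex {x. \<eta> x \<le> c}"
proof (rule convexI)
  fix x y :: 'a and s t :: real
  assume "x \<in> {x. \<eta> x \<le> c}" "y \<in> {x. \<eta> x \<le> c}" and st: "0 \<le> s" "0 \<le> t" "s + t = 1"
  then have "\<eta> (s *\<^sub>R x + t *\<^sub>R y) \<le> s * \<eta> x + t * \<eta> y"
    using assms by (simp add: convex_on_def)
  also have "\<dots> \<le> s * c + t * c"
    using st \<open>x \<in> _\<close> \<open>y \<in> _\<close> by (intro add_mono mult_left_mono) auto
  also have "\<dots> = c" using st by (metis distrib_right mult_1)
  finally show "s *\<^sub>R x + t *\<^sub>R y \<in> {x. \<eta> x \<le> c}" by simp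
qed

text \<open>The constraints are removed one at a time: the last one gets its multiplier over the set cut out by the others, and
\<open>\<phi>\<close> is replaced by the resulting Lagrangian. This is possible because the Slater point serves for every
intermediate problem.\<close>

lemma lagrange_multipliers:
  fixes \<phi> :: "'a::real_vector \<Rightarrow> real" and \<eta> :: "nat \<Rightarrow> 'a \<Rightarrow> real"
  assumes "convex_on UNIV \<phi>" "\<And>i. i \<in> {1..m} \<Longrightarrow> convex_on UNIV (\<eta> i)"
    and "\<And>i. i \<in> {1..m} \<Longrightarrow> \<eta> i xhat < 0"
    and "\<And>x. (\<And>i. i \<in> {1..m} \<Longrightarrow> \<eta> i x \<le> 0) \<Longrightarrow> 0 \<le> \<phi> x"
  shows "\<exists>l. (\<forall>i\<in>{1..m}. 0 \<le> l i) \<and> (\<forall>x. 0 \<le> \<phi> x + (\<Sum>i\<in>{1..m}. l i * \<eta> i x))"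
  using assms
proof (induction m arbitrary: \<phi>)
  case (Suc m)
  define C where "C = {x. \<forall>i\<in>{1..m}. \<eta> i x \<le> 0}"
  have "convex {x. \<eta> i x \<le> 0}" if "i \<in> {1..m}" for i
    using that by (intro convex_sublevel Suc.prems(2)) auto
  moreover have "C = (\<Inter>i\<in>{1..m}. {x. \<eta> i x \<le> 0})" by (auto simp: C_def)
  ultimately have C: "convex C" by (simp only:) (rule convex_INT)
  have "\<exists>c\<ge>0. \<forall>x\<in>C. 0 \<le> \<phi> x + c * \<eta> (Suc m) x"
  proof (rule lagrange_multiplier[where xhat = xhat])
    show "xhat \<in> C" using Suc.prems(3) by (auto simp: C_def intro!: less_imp_le)
    show "0 \<le> \<phi> x" if "x \<in> C" "\<eta> (Suc m) x \<le> 0" for x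
      using that by (intro Suc.prems(4)) (auto simp: C_def le_Suc_eq)
  qed (use Suc.prems C in \<open>auto intro: convex_on_subset\<close>)
  then obtain c where c: "c \<ge> 0" "\<And>x. x \<in> C \<Longrightarrow> 0 \<le> \<phi> x + c * \<eta> (Suc m) x" by auto
  have "convex_on UNIV (\<lambda>x. \<phi> x + c * \<eta> (Suc m) x)"
    using Suc.prems c by (intro convex_on_add convex_on_cmul) auto
  from Suc.IH[OF this] Suc.prems(2,3) c(2)
  obtain l where l: "\<forall>i\<in>{1..m}. 0 \<le> l i"
    "\<And>x. 0 \<le> \<phi> x + c * \<eta> (Suc m) x + (\<Sum>i\<in>{1..m}. l i * \<eta> i x)"
    by (auto simp: C_def)
  have "(\<Sum>i\<in>{1..m}. (l(Suc m := c)) i * \<eta> i x) = (\<Sum>i\<in>{1..m}. l i * \<eta> i x)" for x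
    by (intro sum.cong) auto
  with l c(1) show ?case
    by (intro exI[of _ "l(Suc m := c)"]) (auto simp: algebra_simps le_Suc_eq)
qed simp

section \<open>Convex polynomials bounded below\<close>

lemma continuous_on_peval: "continuous_on S (peval q)"
  unfolding peval_def by (intro continuous_intros)

text \<open>Along the line, the polynomial is univariate, and a nonconstant univariate polynomial is unbounded on every ray.\<close>

lemma peval_bounded_ray_constant:
  assumes "\<And>t. 0 \<le> t \<Longrightarrow> \<bar>peval q (x + t *\<^sub>R v)\<bar> \<le> B"
  shows "peval q (x + t *\<^sub>R v) = peval q x"
proof -
  let ?P = "line_subst x q"
  define c where "c k = peval (coeff ?P k) (x + v)" for k
  have eq: "peval q (x + t *\<^sub>R v) = (\<Sum>k\<le>degree ?P. c k * t ^ k)" for t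
    using peval_line_subst[of x q t "x + v"] by (simp add: poly_altdef c_def)
  have "c k = 0" if k: "k \<noteq> 0" "k \<le> degree ?P" for k
  proof (rule ccontr)
    assume "c k \<noteq> 0"
    with k have "eventually (\<lambda>t. norm (\<Sum>i\<le>degree ?P. c i * t ^ i) \<ge> B + 1) at_infinity"
      by (intro polyfun_extremal) auto
    then obtain b where b: "\<And>t. b \<le> norm t \<Longrightarrow> B + 1 \<le> norm (\<Sum>i\<le>degree ?P. c i * t ^ i)"
      by (auto simp: eventually_at_infinity)
    show False using b[of "max b 0"] assms[of "max b 0"] by (simp add: eq)
  qed
  then have "peval q (x + t *\<^sub>R v) = c 0" for t
    unfolding eq by (subst sum.remove[of _ 0]) auto
  from this[of t] this[of 0] show ?thesis by simp
qed

text \<open>Let \<open>V\<close> be the space of directions along which the polynomial is constant; it suffices to minimize over the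
orthogonal complement \<open>W\<close>. If a sublevel set in \<open>W\<close> were unbounded, a limit direction \<open>v\<close> of its points would be a
unit vector in \<open>W\<close>. By convexity, the polynomial is bounded above on every ray in direction \<open>v\<close>; being bounded
below as well, it is constant along it, so \<open>v\<close> would lie in \<open>V\<close>. Thus the sublevel set is compact.\<close>

lemma convex_poly_attains_min:
  fixes q :: "'n::finite rpoly"
  assumes cvx: "convex_on UNIV (peval q)" and below: "\<And>x. c \<le> peval q x"
  shows "\<exists>x0. \<forall>x. peval q x0 \<le> peval q x"
proof -
  let ?q = "peval q"
  define V where "V = {v. \<forall>x t. ?q (x + t *\<^sub>R v) = ?q x}"
  have V: "subspace V"
    unfolding subspace_def
  proof (intro conjI ballI allI)
    fix v w assume "v \<in> V" "w \<in> V"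
    then have "?q ((x + t *\<^sub>R v) + t *\<^sub>R w) = ?q x" for x t by (simp add: V_def)
    then show "v + w \<in> V" by (simp add: V_def scaleR_add_right add.assoc)
  qed (auto simp: V_def)
  define W where "W = {w. \<forall>v\<in>V. orthogonal v w}"
  have W: "subspace W" unfolding W_def by (rule subspace_orthogonal_to_vectors)
  define S where "S = {x \<in> W. ?q x \<le> ?q 0}"
  have "bounded S"
  proof (rule ccontr)
    assume "\<not> bounded S"
    then have "\<exists>x\<in>S. real n + 1 \<le> norm x" for n
      by (auto simp: bounded_iff intro: less_imp_le) (meson linorder_not_le nle_le)
    then obtain X where X: "\<And>n. X n \<in> S" "\<And>n. real n + 1 \<le> norm (X n)" by metis
    define D where "D n = X n /\<^sub>R norm (X n)" for n
    have Xnz: "norm (X n) > 0" for n using X(2)[of n] by linarith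
    then have "D n \<in> sphere 0 1" for n by (auto simp: D_def)
    with compact_sphere[of 0 1] obtain v r where v: "v \<in> sphere 0 1" "strict_mono r" "(D \<circ> r) \<longlonglongrightarrow> v"
      unfolding compact_def by metis
    have "D n \<in> W" for n
      unfolding D_def using X(1) W by (auto simp: S_def intro: subspace_scale)
    then have vW: "v \<in> W"
      using closed_sequentially[OF closed_subspace[OF W], of "D \<circ> r" v] v(3) by auto
    have ray: "?q (x + t *\<^sub>R v) \<le> max (?q x) (?q 0)" if t: "t \<ge> 0" for x t
    proof -
      \<comment> \<open>points at distance about \<open>t\<close> from \<open>x\<close> on the segments from \<open>x\<close> to \<open>X n\<close>; they converge to \<open>x + t *\<^sub>R v\<close>\<close>
      define Y where "Y n = x + t *\<^sub>R (D n - inverse (norm (X n)) *\<^sub>R x)" for n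
      have "filterlim (\<lambda>n. norm (X n)) at_top sequentially"
      proof (rule filterlim_at_top_mono[OF filterlim_real_sequentially always_eventually], rule allI)
        show "real n \<le> norm (X n)" for n using X(2)[of n] by linarith
      qed
      then have "(\<lambda>n. inverse (norm (X n))) \<longlonglongrightarrow> 0"
        by (rule tendsto_inverse_0_at_top)
      then have "(\<lambda>n. inverse (norm (X (r n)))) \<longlonglongrightarrow> 0"
        using LIMSEQ_subseq_LIMSEQ[OF _ v(2)] by (fastforce simp: o_def)
      with v(3) have "(\<lambda>n. Y (r n)) \<longlonglongrightarrow> x + t *\<^sub>R (v - 0 *\<^sub>R x)"
        unfolding Y_def o_def by (intro tendsto_intros)
      then have lim: "(\<lambda>n. ?q (Y (r n))) \<longlonglongrightarrow> ?q (x + t *\<^sub>R v)"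
        using continuous_on_tendsto_compose[OF continuous_on_peval[of UNIV q]] by simp
      have "?q (Y n) \<le> max (?q x) (?q 0)" if n: "t \<le> real n" for n
      proof -
        let ?s = "t / norm (X n)"
        have s: "0 \<le> ?s" "?s \<le> 1" using t n X(2)[of n] Xnz[of n] by auto
        have "Y n = (1 - ?s) *\<^sub>R x + ?s *\<^sub>R X n"
          by (simp add: Y_def D_def algebra_simps divide_inverse)
        then have "?q (Y n) \<le> (1 - ?s) * ?q x + ?s * ?q (X n)"
          using convex_onD[OF cvx s] by simp
        also have "\<dots> \<le> (1 - ?s) * max (?q x) (?q 0) + ?s * max (?q x) (?q 0)"
          using s X(1)[of n] by (intro add_mono mult_left_mono) (auto simp: S_def)
        finally show ?thesis by (simp add: algebra_simps)
      qed
      moreover have "eventually (\<lambda>n. t \<le> real (r n)) sequentially"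
        using eventually_ge_at_top[of "nat \<lceil>t\<rceil>"] 
        by eventually_elim (use seq_suble[OF v(2)] in \<open>meson nat_ceiling_le_eq order_trans\<close>)
      ultimately have "eventually (\<lambda>n. ?q (Y (r n)) \<le> max (?q x) (?q 0)) sequentially"
        by (auto elim: eventually_mono)
      with lim show ?thesis by (intro tendsto_upperbound) auto
    qed
    have "?q (x + t *\<^sub>R v) = ?q x" for x t
    proof (rule peval_bounded_ray_constant)
      fix s :: real assume "0 \<le> s"
      then show "\<bar>?q (x + s *\<^sub>R v)\<bar> \<le> \<bar>c\<bar> + \<bar>max (?q x) (?q 0)\<bar>"
        using ray[of s x] below[of "x + s *\<^sub>R v"] by linarith
    qed
    then have "v \<in> V" by (simp add: V_def)
    with vW have "v = 0" by (auto simp: W_def orthogonal_def)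
    with v(1) show False by simp
  qed
  moreover have "closed S"
  proof -
    have "S = W \<inter> {x. ?q x \<le> ?q 0}" by (auto simp: S_def)
    then show ?thesis
      using closed_subspace[OF W] closed_Collect_le[OF continuous_on_peval[of UNIV q] continuous_on_const] by auto
  qed
  ultimately have "compact S" by (simp add: compact_eq_bounded_closed)
  moreover have "0 \<in> S" using W by (simp add: S_def subspace_0)
  ultimately obtain x0 where x0: "x0 \<in> S" "\<And>x. x \<in> S \<Longrightarrow> ?q x0 \<le> ?q x"
    using continuous_attains_inf[OF _ _ continuous_on_peval] by (metis empty_iff)
  have "?q x0 \<le> ?q x" for x
  proof -
    obtain y z where yz: "y \<in> span V" "\<And>w. w \<in> span V \<Longrightarrow> orthogonal z w" "x = y + z"
      using orthogonal_subspace_decomp_exists[of V x] by blast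
    have y: "y \<in> V" using yz(1) V span_eq_iff by blast
    have z: "z \<in> W" using yz(2) by (auto simp: W_def orthogonal_commute span_base)
    have "?q x = ?q (z + 1 *\<^sub>R y)" using yz(3) by (simp add: add.commute)
    then have "?q x = ?q z" using y by (simp only: V_def mem_Collect_eq)
    then show ?thesis using x0(2)[of z] x0(1) z by (cases "?q z \<le> ?q 0") (auto simp: S_def)
  qed
  then show ?thesis by blast
qed

text \<open>At a minimizer \<open>x0\<close> the gradient vanishes, so the polynomial is its tangent remainder at \<open>x0\<close> plus the
nonnegative constant \<open>peval q x0\<close>.\<close>

lemma nonneg_imp_sos:
  assumes rem: "\<And>u. sos (tangent_remainder q u)" and nonneg: "\<And>x. 0 \<le> peval q x"
  shows "sos q"
proof -
  obtain x0 where x0: "\<And>x. peval q x0 \<le> peval q x"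
    using convex_poly_attains_min[OF convex_on_of_tangent_remainder[OF rem] nonneg] by blast
  have "peval (partial i q) x0 = 0" for i
    by (rule DERIV_local_min[OF peval_partial, of 1]) (auto simp: x0)
  then have "q = tangent_remainder q x0 + Const (peval q x0)"
    by (simp add: tangent_remainder_def)
  then show ?thesis
    using sos_add[OF rem sos_Const[OF nonneg], of x0 x0] by simp
qed

section \<open>Degrees of sums of squares\<close>

definition total_degree :: "'n::finite expo \<Rightarrow> nat" where
  "total_degree \<alpha> = (\<Sum>i\<in>UNIV. Poly_Mapping.lookup \<alpha> i)"

lemma total_degree_add: "total_degree (\<alpha> + \<beta>) = total_degree \<alpha> + total_degree \<beta>"
  by (simp add: total_degree_def lookup_add sum.distrib)

lemma expos_iff: "\<alpha> \<in> expos k \<longleftrightarrow> total_degree \<alpha> \<le> k"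
  by (simp add: expos_def total_degree_def)

lemma expos_add: "\<alpha> \<in> expos k \<Longrightarrow> \<beta> \<in> expos l \<Longrightarrow> \<alpha> + \<beta> \<in> expos (k + l)"
  by (simp add: expos_iff total_degree_add)

lemma polys_iff: "p \<in> polys k \<longleftrightarrow> (\<forall>\<alpha>. \<alpha> \<notin> expos k \<longrightarrow> Poly_Mapping.lookup p \<alpha> = 0)"
  by (auto simp: polys_def in_keys_iff)

lemma polys_add: "p \<in> polys k \<Longrightarrow> q \<in> polys k \<Longrightarrow> p + q \<in> polys k"
  by (simp add: polys_iff lookup_add)

lemma polys_diff: "p \<in> polys k \<Longrightarrow> q \<in> polys k \<Longrightarrow> p - q \<in> polys k"
  by (simp add: polys_iff lookup_minus)

lemma polys_0 [simp]: "0 \<in> polys k"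
  by (simp add: polys_iff)

lemma polys_sum: "(\<And>a. a \<in> A \<Longrightarrow> p a \<in> polys k) \<Longrightarrow> sum p A \<in> polys k"
  by (induction A rule: infinite_finite_induct) (auto intro: polys_add)

lemma polys_Const_mult: "p \<in> polys k \<Longrightarrow> Const c * p \<in> polys k"
  by (simp add: polys_iff)

lemma polys_Const [simp]: "Const c \<in> polys k"
  by (auto simp: polys_iff Const_def expos_iff total_degree_def lookup_single when_def)

lemma polys_Var: "1 \<le> k \<Longrightarrow> Var i \<in> polys k"
  by (auto simp: polys_iff Var_def expos_iff total_degree_def lookup_single when_def)

text \<open>If some square had too high a degree, consider among all exponents that occur those of maximal total degree, and among
these an exponent \<open>\<mu>\<close> with the largest sum of squared entries. By the parallelogram law, \<open>\<mu> + \<mu>\<close> is not the sum of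
any other two occurring exponents. Its coefficient in the sum of squares is hence a sum of squares of real numbers
that are not all zero, against the degree bound.\<close>

lemma sum_squares_degree:
  fixes u :: "nat \<Rightarrow> 'n::finite rpoly"
  assumes "(\<Sum>k<r. u k ^ 2) \<in> polys (2 * d)" "k < r"
  shows "u k \<in> polys d"
proof (rule ccontr)
  assume "u k \<notin> polys d"
  then obtain \<alpha>0 where \<alpha>0: "\<alpha>0 \<in> Poly_Mapping.keys (u k)" "\<alpha>0 \<notin> expos d"
    by (auto simp: polys_def)
  define A where "A = (\<Union>k<r. Poly_Mapping.keys (u k))"
  have A: "finite A" "A \<noteq> {}" using \<alpha>0 assms(2) unfolding A_def by (simp, blast)
  define D where "D = Max (total_degree ` A)"
  have D: "total_degree \<alpha> \<le> D" if "\<alpha> \<in> A" for \<alpha>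
    using A that by (simp add: D_def)
  have "d < D" using D[of \<alpha>0] \<alpha>0 assms(2) by (force simp: A_def expos_iff)
  define B where "B = {\<alpha> \<in> A. total_degree \<alpha> = D}"
  have "D \<in> total_degree ` A" unfolding D_def using A by (intro Max_in) auto
  then have B: "finite B" "B \<noteq> {}" using A by (auto simp: B_def)
  define sq :: "'n expo \<Rightarrow> nat" where "sq \<alpha> = (\<Sum>i\<in>UNIV. Poly_Mapping.lookup \<alpha> i ^ 2)" for \<alpha>
  obtain \<mu> where \<mu>: "\<mu> \<in> B" "\<And>\<alpha>. \<alpha> \<in> B \<Longrightarrow> sq \<alpha> \<le> sq \<mu>"
    using Max_in[of "sq ` B"] Max_ge[of "sq ` B"] B by (metis (no_types, lifting) finite_imageI image_iff image_is_empty)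
  have uniq: "\<alpha> = \<mu> \<and> \<beta> = \<mu>" if "\<alpha> \<in> A" "\<beta> \<in> A" "\<alpha> + \<beta> = \<mu> + \<mu>" for \<alpha> \<beta>
  proof -
    have "total_degree \<alpha> + total_degree \<beta> = 2 * D"
      using that(3) \<mu>(1) by (metis (mono_tags, lifting) B_def mem_Collect_eq mult_2 total_degree_add)
    with D[OF that(1)] D[OF that(2)] have "\<alpha> \<in> B" "\<beta> \<in> B" using that by (auto simp: B_def)
    then have le: "int (sq \<alpha>) + int (sq \<beta>) \<le> 2 * int (sq \<mu>)" using \<mu>(2)[of \<alpha>] \<mu>(2)[of \<beta>] by simp
    let ?l = "\<lambda>\<alpha> i. int (Poly_Mapping.lookup \<alpha> i)"
    have l: "?l \<alpha> i + ?l \<beta> i = 2 * ?l \<mu> i" for i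
      using arg_cong[OF that(3), of "\<lambda>\<gamma>. ?l \<gamma> i"] by (simp add: lookup_add)
    have "(\<Sum>i\<in>UNIV. (?l \<alpha> i - ?l \<beta> i) ^ 2) =
       (\<Sum>i\<in>UNIV. 2 * ?l \<alpha> i ^ 2 + 2 * ?l \<beta> i ^ 2 - (?l \<alpha> i + ?l \<beta> i) ^ 2)"
      by (simp add: power2_eq_square algebra_simps)
    also have "\<dots> = 2 * int (sq \<alpha>) + 2 * int (sq \<beta>) - 4 * int (sq \<mu>)"
      unfolding l by (simp add: sq_def sum.distrib sum_subtractf sum_distrib_left power_mult_distrib)
    also have "\<dots> \<le> 0" using le by simp
    finally have "(\<Sum>i\<in>UNIV. (?l \<alpha> i - ?l \<beta> i) ^ 2) = 0"
      by (intro antisym sum_nonneg) auto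
    then have "?l \<alpha> i = ?l \<beta> i" for i by (simp add: sum_nonneg_eq_0_iff)
    with l have "?l \<alpha> i = ?l \<mu> i \<and> ?l \<beta> i = ?l \<mu> i" for i by (metis add_left_cancel mult_2 mult_cancel_left zero_neq_numeral)
    then show ?thesis by (auto simp: poly_mapping_eq_iff fun_eq_iff)
  qed
  have coeff: "Poly_Mapping.lookup (u j ^ 2) (\<mu> + \<mu>) = Poly_Mapping.lookup (u j) \<mu> ^ 2" if "j < r" for j
  proof -
    have j: "u j = (\<Sum>\<alpha>\<in>A. Poly_Mapping.single \<alpha> (Poly_Mapping.lookup (u j) \<alpha>))"
      using A that by (intro sum_of_terms) (auto simp: A_def)
    have "Poly_Mapping.lookup (u j ^ 2) (\<mu> + \<mu>) =
       (\<Sum>\<alpha>\<in>A. \<Sum>\<beta>\<in>A. Poly_Mapping.lookup (u j) \<alpha> * Poly_Mapping.lookup (u j) \<beta> when \<alpha> + \<beta> = \<mu> + \<mu>)"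
      unfolding power2_eq_square by (subst j, subst (2) j) (simp add: sum_product mult_single lookup_sum lookup_single)
    also have "\<dots> = (\<Sum>\<alpha>\<in>A. \<Sum>\<beta>\<in>A. if \<beta> = \<mu> then (if \<alpha> = \<mu> then Poly_Mapping.lookup (u j) \<mu> ^ 2 else 0) else 0)"
      by (intro sum.cong refl) (auto simp: when_def power2_eq_square dest: uniq)
    also have "\<dots> = Poly_Mapping.lookup (u j) \<mu> ^ 2"
      using A \<mu>(1) by (simp add: B_def)
    finally show ?thesis .
  qed
  have "\<mu> + \<mu> \<notin> expos (2 * d)"
    using \<mu>(1) \<open>d < D\<close> by (simp add: expos_iff total_degree_add B_def)
  then have "(\<Sum>k<r. Poly_Mapping.lookup (u k) \<mu> ^ 2) = 0"
    using assms(1) coeff by (auto simp: polys_iff lookup_sum)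
  then have "\<forall>k<r. Poly_Mapping.lookup (u k) \<mu> = 0"
    by (simp add: sum_nonneg_eq_0_iff)
  then show False using \<mu>(1) by (auto simp: B_def A_def in_keys_iff)
qed

section \<open>Moment functionals\<close>

lemma Lfun_add: "Lfun d y (p + q) = Lfun d y p + Lfun d y q"
  by (simp add: Lfun_def lookup_add distrib_right sum.distrib)

lemma Lfun_diff: "Lfun d y (p - q) = Lfun d y p - Lfun d y q"
  by (simp add: Lfun_def lookup_minus left_diff_distrib sum_subtractf)

lemma Lfun_sum: "Lfun d y (sum p A) = (\<Sum>a\<in>A. Lfun d y (p a))"
  unfolding Lfun_def lookup_sum sum_distrib_right by (rule sum.swap)

lemma Lfun_Const_mult: "Lfun d y (Const c * p) = c * Lfun d y p"
  by (simp add: Lfun_def sum_distrib_left mult.assoc)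

lemma Lfun_single: "\<alpha> \<in> expos (2 * d) \<Longrightarrow> Lfun d y (Poly_Mapping.single \<alpha> c) = c * y \<alpha>"
  by (simp add: Lfun_def lookup_single when_def if_distrib if_distribR finite_expos cong: if_cong)

lemma Lfun_Const: "Lfun d y (Const c) = c * y 0"
  unfolding Const_def by (rule Lfun_single) (simp add: expos_iff total_degree_def)

lemma Lfun_square:
  assumes "u \<in> polys d"
  shows "Lfun d y (u ^ 2) = (\<Sum>\<alpha>\<in>expos d. \<Sum>\<beta>\<in>expos d.
     Poly_Mapping.lookup u \<alpha> * moment_matrix y \<alpha> \<beta> * Poly_Mapping.lookup u \<beta>)"
proof -
  have u: "u = (\<Sum>\<alpha>\<in>expos d. Poly_Mapping.single \<alpha> (Poly_Mapping.lookup u \<alpha>))" (is "_ = ?u")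
    using assms by (intro sum_of_terms finite_expos) (simp add: polys_def)
  have "Lfun d y (?u ^ 2) = (\<Sum>\<alpha>\<in>expos d. \<Sum>\<beta>\<in>expos d.
     Poly_Mapping.lookup u \<alpha> * moment_matrix y \<alpha> \<beta> * Poly_Mapping.lookup u \<beta>)"
    unfolding power2_eq_square sum_product Lfun_sum moment_matrix_def mult_single
    by (intro sum.cong refl) (simp add: Lfun_single mult_2 expos_add)
  then show ?thesis by (simp only: u [symmetric])
qed

text \<open>Moment matrices only control squares of polynomials of degree at most \<open>d\<close>; the degree bound on the summands
ensures that no others occur.\<close>

lemma Lfun_sos_nonneg:
  assumes "p \<in> Sigma_sos (2 * d)" "psd_on (expos d) (moment_matrix y)"
  shows "0 \<le> Lfun d y p"
proof -
  obtain r u where p: "p = (\<Sum>k<(r::nat). u k ^ 2)" "p \<in> polys (2 * d)"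
    using assms(1) by (auto simp: Sigma_sos_def sos_def)
  have "0 \<le> Lfun d y (u k ^ 2)" if "k < r" for k
    using assms(2) sum_squares_degree[of u r d k] p that
    by (simp add: Lfun_square psd_on_def)
  then show ?thesis unfolding p(1) Lfun_sum by (intro sum_nonneg) auto
qed

text \<open>The moments of the measure of mass \<open>w\<close> concentrated at \<open>x\<close>, truncated at degree \<open>2 * d\<close>.\<close>

definition point_moments :: "nat \<Rightarrow> real \<Rightarrow> real ^ 'n::finite \<Rightarrow> 'n expo \<Rightarrow> real" where
  "point_moments d w x = restrict (\<lambda>\<alpha>. w * monom_eval \<alpha> x) (expos (2 * d))"

lemma Lfun_point_moments:
  assumes "p \<in> polys (2 * d)"
  shows "Lfun d (point_moments d w x) p = w * peval p x"
proof -
  have "peval p x = (\<Sum>\<alpha>\<in>expos (2 * d). Poly_Mapping.lookup p \<alpha> * monom_eval \<alpha> x)"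
    using assms by (intro peval_superset finite_expos) (simp add: polys_def)
  then show ?thesis
    by (simp add: Lfun_def point_moments_def sum_distrib_left mult_ac)
qed

lemma psd_point_moments:
  fixes x :: "real ^ 'n::finite"
  assumes "w \<ge> 0"
  shows "psd_on (expos d) (moment_matrix (point_moments d w x))"
  unfolding psd_on_def
proof (intro conjI ballI allI)
  fix v :: "'n expo \<Rightarrow> real"
  have "moment_matrix (point_moments d w x) \<alpha> \<beta> = w * (monom_eval \<alpha> x * monom_eval \<beta> x)"
    if "\<alpha> \<in> expos d" "\<beta> \<in> expos d" for \<alpha> \<beta>
    using expos_add[OF that] by (simp add: moment_matrix_def point_moments_def monom_eval_add mult_2)
  then have "(\<Sum>\<alpha>\<in>expos d. \<Sum>\<beta>\<in>expos d. v \<alpha> * moment_matrix (point_moments d w x) \<alpha> \<beta> * v \<beta>) =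
     w * (\<Sum>\<alpha>\<in>expos d. v \<alpha> * monom_eval \<alpha> x) ^ 2"
    unfolding power2_eq_square sum_product
    by (simp only: sum_distrib_left) (intro sum.cong refl, simp add: mult_ac)
  then show "0 \<le> (\<Sum>\<alpha>\<in>expos d. \<Sum>\<beta>\<in>expos d. v \<alpha> * moment_matrix (point_moments d w x) \<alpha> \<beta> * v \<beta>)"
    using assms by simp
qed (simp add: moment_matrix_def add.commute)

section \<open>Duality for the fractional program\<close>

lemma tangent_remainder_polys:
  assumes "q \<in> polys k" "1 \<le> k"
  shows "tangent_remainder q u \<in> polys k"
  unfolding tangent_remainder_def
  using assms by (intro polys_diff polys_sum polys_Const_mult polys_Const polys_Var)

text \<open>Jensen's inequality for the pseudo-expectation \<open>Lfun d y\<close> of total mass \<open>y 0\<close>: apply it to the tangent remainder at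
its barycentre, where the linear terms cancel.\<close>

lemma Lfun_jensen:
  fixes q :: "'n::finite rpoly"
  assumes "psd_on (expos d) (moment_matrix y)" "1 \<le> d" "q \<in> polys (2 * d)" "sos_convex q" "y 0 \<noteq> 0"
  defines "xbar \<equiv> (1 / y 0) *\<^sub>R (\<chi> i. Lfun d y (Var i))"
  shows "y 0 * peval q xbar \<le> Lfun d y q"
proof -
  have "tangent_remainder q xbar \<in> Sigma_sos (2 * d)"
    using assms by (simp add: Sigma_sos_def tangent_remainder_polys sos_convex_tangent_remainder)
  then have "0 \<le> Lfun d y (tangent_remainder q xbar)"
    by (rule Lfun_sos_nonneg) fact
  also have "Lfun d y (tangent_remainder q xbar) = Lfun d y q - peval q xbar * y 0"
    using \<open>y 0 \<noteq> 0\<close>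
    by (simp add: tangent_remainder_def Lfun_diff Lfun_sum Lfun_Const_mult Lfun_Const xbar_def)
  finally show ?thesis by (simp add: mult.commute)
qed

text \<open>The entry at the zero exponent lies on the diagonal of the moment matrix.\<close>

lemma psd_moment_0_nonneg: "psd_on (expos d) (moment_matrix y) \<Longrightarrow> 0 \<le> y 0"
  using psd_on_diag[of "expos d" "moment_matrix y" 0] finite_expos[of d]
  by (simp add: moment_matrix_def expos_iff total_degree_def)

lemma weak_duality:
  assumes "(l, \<gamma>) \<in> feas_D d m f g h" "y \<in> feas_Q d m g h"
  shows "\<gamma> \<le> Lfun d y f"
proof -
  have "0 \<le> Lfun d y (f + (\<Sum>i\<in>{1..m}. Const (l i) * h i) - Const \<gamma> * g)"
    using assms by (intro Lfun_sos_nonneg) (auto simp: feas_D_def feas_Q_def)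
  also have "\<dots> = Lfun d y f + (\<Sum>i\<in>{1..m}. l i * Lfun d y (h i)) - \<gamma> * Lfun d y g"
    by (simp only: Lfun_diff Lfun_add Lfun_sum Lfun_Const_mult)
  moreover have "(\<Sum>i\<in>{1..m}. l i * Lfun d y (h i)) \<le> 0"
    using assms by (intro sum_nonpos mult_nonneg_nonpos) (auto simp: feas_D_def feas_Q_def)
  moreover have "\<gamma> * 1 \<le> \<gamma> * Lfun d y g"
    using assms by (intro mult_left_mono) (auto simp: feas_D_def feas_Q_def)
  ultimately show ?thesis by simp
qed

text \<open>The mass \<open>1 / peval g x\<close> normalizes the value of the functional at \<open>g\<close> to 1 and so turns the ratio into a linear objective;
thus the moment problem relaxes the fractional program.\<close>

lemma feas_Q_point_moments:
  assumes "x \<in> feas_K m h" "0 < peval g x" "f \<in> polys (2 * d)" "g \<in> polys (2 * d)"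
    "\<forall>i\<in>{1..m}. h i \<in> polys (2 * d)"
  shows "point_moments d (1 / peval g x) x \<in> feas_Q d m g h"
    and "Lfun d (point_moments d (1 / peval g x) x) f = obj_FP f g x"
proof -
  have "point_moments d (1 / peval g x) x \<in> mom_space d"
    by (simp add: point_moments_def mom_space_def)
  then show "point_moments d (1 / peval g x) x \<in> feas_Q d m g h"
    using assms by (auto simp: feas_Q_def feas_K_def Lfun_point_moments psd_point_moments divide_nonpos_pos)
qed (use assms in \<open>simp add: Lfun_point_moments obj_FP_def\<close>)


text \<open>The Lagrangian of the convex problem of minimizing $f-\gamma g$ over the feasible set is nonnegative on the whole
space. It is a nonnegative combination of SOS-convex polynomials, because \<open>\<gamma> \<ge> 0\<close> is the coefficient of \<open>- g\<close>;
therefore it is a sum of squares.\<close>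

lemma strong_duality:
  fixes f g :: "'n::finite rpoly"
  assumes polys: "f \<in> polys (2 * d)" "g \<in> polys (2 * d)" "\<forall>i\<in>{1..m}. h i \<in> polys (2 * d)"
    and cvx: "sos_convex f" "sos_convex (- g)" "\<forall>i\<in>{1..m}. sos_convex (h i)"
    and slater: "\<forall>i\<in>{1..m}. peval (h i) xhat < 0"
    and \<gamma>: "0 \<le> \<gamma>" "\<And>x. x \<in> feas_K m h \<Longrightarrow> \<gamma> * peval g x \<le> peval f x"
  shows "\<exists>l. (l, \<gamma>) \<in> feas_D d m f g h"
proof -
  define F where "F = f + Const \<gamma> * (- g)"
  have F: "sos (tangent_remainder F u)" for u
    unfolding F_def tangent_remainder_add tangent_remainder_Const_mult
    using cvx \<gamma> by (intro sos_add sos_Const_mult sos_convex_tangent_remainder) auto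
  have "\<exists>l. (\<forall>i\<in>{1..m}. 0 \<le> l i) \<and> (\<forall>x. 0 \<le> peval F x + (\<Sum>i\<in>{1..m}. l i * peval (h i) x))"
  proof (rule lagrange_multipliers)
    show "convex_on UNIV (peval F)" by (intro convex_on_of_tangent_remainder F)
    show "convex_on UNIV (peval (h i))" if "i \<in> {1..m}" for i
      using cvx that by (intro convex_on_of_tangent_remainder sos_convex_tangent_remainder) auto
    show "0 \<le> peval F x" if "\<And>i. i \<in> {1..m} \<Longrightarrow> peval (h i) x \<le> 0" for x
      using \<gamma>(2)[of x] that by (simp add: F_def feas_K_def)
  qed (use slater in auto)
  then obtain l where l: "\<And>i. i \<in> {1..m} \<Longrightarrow> 0 \<le> l i"
    "\<And>x. 0 \<le> peval F x + (\<Sum>i\<in>{1..m}. l i * peval (h i) x)" by blast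
  define q where "q = F + (\<Sum>i\<in>{1..m}. Const (l i) * h i)"
  have "sos q"
  proof (rule nonneg_imp_sos)
    show "sos (tangent_remainder q u)" for u
      unfolding q_def tangent_remainder_add tangent_remainder_sum tangent_remainder_Const_mult
      using cvx l by (intro sos_add F sos_sum sos_Const_mult sos_convex_tangent_remainder) auto
    show "0 \<le> peval q x" for x using l(2)[of x] by (simp add: q_def)
  qed
  moreover have q: "q = f + (\<Sum>i\<in>{1..m}. Const (restrict l {1..m} i) * h i) - Const \<gamma> * g"
    by (simp add: q_def F_def)
  moreover have "q \<in> polys (2 * d)"
    unfolding q using polys by (intro polys_add polys_diff polys_sum polys_Const_mult) auto
  ultimately have "(restrict l {1..m}, \<gamma>) \<in> feas_D d m f g h"
    using l \<gamma> by (simp add: feas_D_def Sigma_sos_def)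
  then show ?thesis by blast
qed

theorem theorem4p5:
  fixes d m :: nat
    and f g :: "'n::finite rpoly"
    and h :: "nat \<Rightarrow> 'n rpoly"
  assumes "d \<ge> 1"
    and "f \<in> polys (2 * d)" and "g \<in> polys (2 * d)"
    and "\<forall>i\<in>{1..m}. h i \<in> polys (2 * d)"
    and "sos_convex f" and "sos_convex (- g)"
    and "\<forall>i\<in>{1..m}. sos_convex (h i)"
    and "feas_K m h \<noteq> {}"
    and "\<forall>x\<in>feas_K m h. peval f x \<ge> 0 \<and> peval g x > 0"
    and Slater: "\<exists>xhat. \<forall>i\<in>{1..m}. peval (h i) xhat < 0"
  shows "(\<exists>l \<gamma>. is_arg_max snd (\<lambda>z. z \<in> feas_D d m f g h) (l, \<gamma>) \<and>
            inf_FP m f g h = ereal \<gamma> \<and> ereal \<gamma> = inf_Q d m f g h) \<and>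
         (\<forall>y. is_arg_min (\<lambda>y. Lfun d y f) (\<lambda>y. y \<in> feas_Q d m g h) y \<and> y 0 \<noteq> 0 \<longrightarrow>
            is_arg_min (obj_FP f g) (\<lambda>x. x \<in> feas_K m h)
              ((1 / y 0) *\<^sub>R (\<chi> i. Lfun d y (Var i))))"
proof (intro conjI allI impI)
  let ?K = "feas_K m h" and ?Q = "feas_Q d m g h" and ?D = "feas_D d m f g h"
  have fg: "0 \<le> peval f x" "0 < peval g x" if "x \<in> ?K" for x
    using assms(9) that by auto
  have embed: "point_moments d (1 / peval g x) x \<in> ?Q"
    "Lfun d (point_moments d (1 / peval g x) x) f = obj_FP f g x" if "x \<in> ?K" for x
    using feas_Q_point_moments[OF that fg(2)[OF that]] assms(2-4) by auto
  show "\<exists>l \<gamma>. is_arg_max snd (\<lambda>z. z \<in> ?D) (l, \<gamma>) \<and> inf_FP m f g h = ereal \<gamma> \<and> ereal \<gamma> = inf_Q d m f g h"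
  proof -
    \<comment> \<open>the real infimum; it exists because the ratio is nonnegative on the nonempty feasible set\<close>
    define \<gamma> where "\<gamma> = Inf (obj_FP f g ` ?K)"
    have pos: "0 \<le> obj_FP f g x" if "x \<in> ?K" for x
      using fg[OF that] by (simp add: obj_FP_def)
    then have bdd: "bdd_below (obj_FP f g ` ?K)" by (auto simp: bdd_below_def)
    have \<gamma>0: "0 \<le> \<gamma>"
      unfolding \<gamma>_def using pos assms(8) by (intro cInf_greatest) auto
    have "\<gamma> * peval g x \<le> peval f x" if "x \<in> ?K" for x
    proof -
      have "\<gamma> \<le> obj_FP f g x"
        unfolding \<gamma>_def using bdd that by (intro cInf_lower) auto
      then show ?thesis using fg(2)[OF that] by (simp add: obj_FP_def pos_le_divide_eq)
    qed
    then obtain l where l: "(l, \<gamma>) \<in> ?D"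
      using strong_duality[of f d g m h _ \<gamma>] assms \<gamma>0 by blast
    have FP: "inf_FP m f g h = ereal \<gamma>"
      unfolding inf_FP_def \<gamma>_def using ereal_Inf'[OF bdd] assms(8) by (simp add: image_image)
    have "inf_Q d m f g h \<le> inf_FP m f g h"
      unfolding inf_FP_def
    proof (rule INF_greatest)
      fix x assume "x \<in> ?K"
      then show "inf_Q d m f g h \<le> ereal (obj_FP f g x)"
        unfolding inf_Q_def using embed by (metis INF_lower)
    qed
    moreover have "ereal \<gamma>' \<le> inf_Q d m f g h" if "(l', \<gamma>') \<in> ?D" for l' \<gamma>'
      unfolding inf_Q_def using weak_duality[OF that] by (intro INF_greatest) simp
    ultimately have "ereal \<gamma> = inf_Q d m f g h" "\<And>l' \<gamma>'. (l', \<gamma>') \<in> ?D \<Longrightarrow> \<gamma>' \<le> \<gamma>"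
      using l unfolding FP by (auto intro: antisym) (metis ereal_less_eq(3) order_trans)
    with l FP show ?thesis by (fastforce simp: is_arg_max_def)
  qed
  fix y assume y: "is_arg_min (\<lambda>y. Lfun d y f) (\<lambda>y. y \<in> ?Q) y \<and> y 0 \<noteq> 0"
  let ?x = "(1 / y 0) *\<^sub>R (\<chi> i. Lfun d y (Var i))"
  have feas: "1 \<le> Lfun d y g" "\<And>i. i \<in> {1..m} \<Longrightarrow> Lfun d y (h i) \<le> 0" and psd: "psd_on (expos d) (moment_matrix y)"
    using y by (auto simp: is_arg_min_def feas_Q_def)
  have y0: "0 < y 0" using psd_moment_0_nonneg[OF psd] y by simp
  have jensen: "y 0 * peval q ?x \<le> Lfun d y q" if "q \<in> polys (2 * d)" "sos_convex q" for q
    using Lfun_jensen[OF psd assms(1) that] y by simp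
  have "peval (h i) ?x \<le> 0" if "i \<in> {1..m}" for i
  proof -
    have "y 0 * peval (h i) ?x \<le> 0"
      using jensen[of "h i"] feas(2)[OF that] assms(4,7) that by force
    then show ?thesis using y0 by (simp add: mult_le_0_iff)
  qed
  then have xK: "?x \<in> ?K" by (simp add: feas_K_def)
  have "- g \<in> polys (2 * d)" using polys_diff[OF polys_0 assms(3)] by simp
  then have "1 \<le> y 0 * peval g ?x"
    using jensen[of "- g"] assms(6) feas(1) Lfun_diff[of d y 0 g] by (simp add: Lfun_def)
  moreover have "y 0 * peval f ?x \<le> Lfun d y f" using jensen assms(2,5) by simp
  moreover have "peval f ?x * 1 \<le> peval f ?x * (y 0 * peval g ?x)"
    using calculation(1) fg(1)[OF xK] by (intro mult_left_mono)
  moreover have "peval g ?x * (y 0 * peval f ?x) \<le> peval g ?x * Lfun d y f"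
    using calculation(2) fg(2)[OF xK] by (intro mult_left_mono) auto
  ultimately have "peval f ?x \<le> Lfun d y f * peval g ?x" by (simp add: mult_ac)
  then have "obj_FP f g ?x \<le> Lfun d y f"
    using fg(2)[OF xK] by (simp add: obj_FP_def divide_le_eq)
  also have "\<dots> \<le> obj_FP f g x" if "x \<in> ?K" for x
    using y embed[OF that] unfolding is_arg_min_def by (metis not_less)
  finally show "is_arg_min (obj_FP f g) (\<lambda>x. x \<in> ?K) ?x"
    using xK by (fastforce simp: is_arg_min_def not_less)
qed

end
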